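(* Let $n\ge 2$, let $D$ be a non-negative principal divisor on $\mathbb{C}^n$ with support $|D|$, let $f:\mathbb{C}^n\to\mathbb{C}$ be a holomorphic function with ${\sf Div}(f)=D$, and let $\phi$ be the complete Kähler metric on $\mathbb{C}^n\setminus|D|$ given by $$\phi(z,V)=\Big(1+|f(z)|^2u^2\big(|f(z)|^2\big)\Big)\,|df(z)(V)|^2+|V|^2,\qquad z\in\mathbb{C}^n\setminus|D|,\ V\in\mathbb{C}^n,$$ where $u:(0,\infty)\to\mathbb{R}$, $u(t)=\dfrac{t-1}{t\log t}$ (with $u(1)=1$). Then, with $K$, $K^+$ and $\mathcal{K}^X$ denoting the curvatures of $\phi$ defined in the context: (i) If $p\in\mathbb{C}^n\setminus|D|$ and $V\in{\rm Ker}(df(p))$ (with $V\neq 0$), then $K(p,V)\le 0$. In particular, if ${\rm Rank}(df(p))=0$, then $K^+(p)\le 0$. (ii) If $p\in\mathbb{C}^n\setminus|D|$ and $\frac{\partial f}{\partial z_i}(p)\ne 0$ for some $1\le i\le n$, then there exists a non-singular holomorphic vector field $X$ near $p$ such that $X(p)\notin{\rm Ker}(df(p))$ and $\mathcal{K}^X(p)\le 0$. (iii) If $p\in|D|$ and $\frac{\partial f}{\partial z_i}(p)\neq 0$ for some $1\le i\le n$, then there exists a non-singular holomorphic vector field $X$ near $p$ such that $$\lim_{z\to p}\mathcal{K}^X(z)=-4<0,$$ the limit being taken over $z\in\mathbb{C}^n\setminus|D|$.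
   Context: Divisors: for a holomorphic function $f\not\equiv 0$ on a connected complex manifold $M$, ${\sf Div}(f)=\sum_i({\rm ord}_{V_i}f)\,V_i$, where the $V_i$ are the irreducible components of the zero set of $f$ and ${\rm ord}_{V_i}f$ is the order of vanishing of $f$ along $V_i$. Divisors of this form are the non-negative principal divisors. The support $|D|$ of $D={\sf Div}(f)$ is the union of the $V_i$, i.e. the zero set of $f$. The metric $\phi$ is $f^*(g)+$ (Euclidean metric), where $g=\big(1+|w|^2u^2(|w|^2)\big)|dw|^2$ is the Grauert metric on $\mathbb{C}^*$; $\phi(z,V)$ denotes the squared length of the vector $V$ at $z$. The function $u$ is real analytic on $(0,\infty)$, the singularity at $t=1$ being removable with $u(1)=1$. Here $df(z)(V)=\sum_i\frac{\partial f}{\partial z_i}(z)V_i$. Gaussian curvature of a conformal metric $h(T)|dT|^2$ ($h>0$ smooth on an open subset of $\mathbb{C}$): $-2h^{-3}\big(h\,\partial\bar\partial h-\partial h\,\bar\partial h\big)$, with $\partial=\partial/\partial T$, $\bar\partial=\partial/\partial\bar T$. For $p\in\mathbb{C}^n\setminus|D|$ and $0\ne V\in\mathbb{C}^n$, $K(p,V)$ is the holomorphic sectional curvature of $\phi$ at $p$ in the direction $V$ (normalized so that in complex dimension one it is the Gaussian curvature; equivalently, $K(p,V)$ is the maximum of the Gaussian curvatures at $p$ of the restrictions of $\phi$ to germs of embedded Riemann surfaces through $p$ tangent to $V$). $K^+(p)$ is the supremum of $K(p,V)$ over nonzero $V\in\mathbb{C}^n$. A non-singular holomorphic vector field is a nowhere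 vanishing holomorphic vector field, viewed as a $\mathbb{C}^n$-valued holomorphic map. For a non-singular holomorphic vector field $X$ defined near a point, and $z\notin |D|$ in its domain, $\mathcal{K}^X(z)$ is the Gaussian curvature at $z$ of the restriction of $\phi$ to the leaf through $z$ of the foliation defined by $X$. Explicitly: if $Z:B(0,\epsilon)\subset\mathbb{C}\to\mathbb{C}^n\setminus|D|$ is holomorphic with $Z(0)=z$ and $Z'(T)=X(Z(T))$, then $\mathcal{K}^X(z)$ is the Gaussian curvature at $T=0$ of $Z^*\phi=\phi(Z(T),X(Z(T)))\,|dT|^2$. *)

theory Defs
  imports "HOL-Complex_Analysis.Complex_Analysis"
begin

section \<open>Holomorphic functions of several variables\<close>

definition holo_on :: "(complex^'n \<Rightarrow> complex) \<Rightarrow> (complex^'n) set \<Rightarrow> bool" where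
  "holo_on F U \<longleftrightarrow> open U \<and>
     (\<forall>z\<in>U. \<exists>L. (F has_derivative L) (at z) \<and> (\<forall>c v. L (c *s v) = c * L v))"

definition pderiv_z :: "'n \<Rightarrow> (complex^'n \<Rightarrow> complex) \<Rightarrow> complex^'n \<Rightarrow> complex" where
  "pderiv_z i F z = deriv (\<lambda>t. F (z + t *s axis i 1)) 0"

definition cdiff :: "(complex^'n \<Rightarrow> complex) \<Rightarrow> complex^'n \<Rightarrow> complex^'n \<Rightarrow> complex" where
  "cdiff F z V = (\<Sum>i\<in>UNIV. pderiv_z i F z * V $ i)"

text \<open>The matrix of \<open>cdiff F z\<close>, a single row.\<close>

definition jacobian_row :: "(complex^'n \<Rightarrow> complex) \<Rightarrow> complex^'n \<Rightarrow> complex^'n^1" where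
  "jacobian_row F z = (\<chi> r i. pderiv_z i F z)"

section \<open>Divisors\<close>

text \<open>On \<open>\<complex>\<^sup>n\<close> every closed analytic subset is the common zero set of a family of entire functions
  (Cartan's Theorem A), and conversely, so no localisation is needed here.\<close>

definition analytic_subset :: "(complex^'n) set \<Rightarrow> bool" where
  "analytic_subset A \<longleftrightarrow>
     (\<exists>S. (\<forall>g\<in>S. holo_on g UNIV) \<and> A = {z. \<forall>g\<in>S. g z = 0})"

definition irreducible_analytic :: "(complex^'n) set \<Rightarrow> bool" where
  "irreducible_analytic A \<longleftrightarrow> analytic_subset A \<and> A \<noteq> {} \<and>
     (\<forall>B C. analytic_subset B \<and> analytic_subset C \<and> A = B \<union> C \<longrightarrow> A = B \<or> A = C)"

definition irreducible_component :: "(complex^'n) set \<Rightarrow> (complex^'n) set \<Rightarrow> bool" where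
  "irreducible_component A V \<longleftrightarrow> irreducible_analytic V \<and> V \<subseteq> A \<and>
     (\<forall>W. irreducible_analytic W \<and> V \<subseteq> W \<and> W \<subseteq> A \<longrightarrow> W = V)"

text \<open>The degree of the lowest nonzero homogeneous term of the Taylor expansion of \<open>f\<close> at \<open>q\<close>.\<close>

definition order_at :: "(complex^'n \<Rightarrow> complex) \<Rightarrow> complex^'n \<Rightarrow> nat" where
  "order_at f q = (LEAST m. \<exists>v. (deriv ^^ m) (\<lambda>t. f (q + t *s v)) 0 \<noteq> 0)"

text \<open>The order of vanishing along \<open>V\<close> is the order at a generic point of \<open>V\<close>; by upper
  semicontinuity of \<open>order_at f\<close> this is the minimum over \<open>V\<close>.\<close>

definition order_along :: "(complex^'n) set \<Rightarrow> (complex^'n \<Rightarrow> complex) \<Rightarrow> nat" where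
  "order_along V f = (INF q\<in>V. order_at f q)"

text \<open>A non-negative divisor is represented by the coefficient function of the formal sum.
  \<open>Div_of f\<close> is meaningful for \<open>f\<close> not identically zero.\<close>

type_synonym 'n divisor = "(complex^'n) set \<Rightarrow> nat"

definition Div_of :: "(complex^'n \<Rightarrow> complex) \<Rightarrow> ('n::finite) divisor" where
  "Div_of f V = (if irreducible_component {z. f z = 0} V then order_along V f else 0)"

definition nonneg_principal_divisor :: "('n::finite) divisor \<Rightarrow> bool" where
  "nonneg_principal_divisor D \<longleftrightarrow>
     (\<exists>f. holo_on f UNIV \<and> (\<exists>z. f z \<noteq> 0) \<and> Div_of f = D)"

definition div_support :: "('n::finite) divisor \<Rightarrow> (complex^'n) set" where
  "div_support D = \<Union>{V. D V \<noteq> 0}"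

section \<open>The metric\<close>

definition u_fun :: "real \<Rightarrow> real" where
  "u_fun t = (if t = 1 then 1 else (t - 1) / (t * ln t))"

text \<open>Metrics are given by the squared length \<open>\<phi> z V\<close> of the vector \<open>V\<close> at \<open>z\<close>.\<close>

definition grauert_metric :: "(complex^'n \<Rightarrow> complex) \<Rightarrow> complex^'n \<Rightarrow> complex^'n \<Rightarrow> real" where
  "grauert_metric f z V =
     (1 + (cmod (f z))\<^sup>2 * (u_fun ((cmod (f z))\<^sup>2))\<^sup>2) * (cmod (cdiff f z V))\<^sup>2 + (norm V)\<^sup>2"

section \<open>Curvature\<close>

definition d_z :: "(complex \<Rightarrow> complex) \<Rightarrow> complex \<Rightarrow> complex" where
  "d_z F T = (frechet_derivative F (at T) 1 - \<i> * frechet_derivative F (at T) \<i>) / 2"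

definition d_zbar :: "(complex \<Rightarrow> complex) \<Rightarrow> complex \<Rightarrow> complex" where
  "d_zbar F T = (frechet_derivative F (at T) 1 + \<i> * frechet_derivative F (at T) \<i>) / 2"

text \<open>The expression under \<open>Re\<close> is real.\<close>

definition gauss_curvature :: "(complex \<Rightarrow> real) \<Rightarrow> complex \<Rightarrow> real" where
  "gauss_curvature h T = (let H = (\<lambda>T. complex_of_real (h T)) in
     Re (- 2 / H T ^ 3 * (H T * d_z (d_zbar H) T - d_z H T * d_zbar H T)))"

definition pd_z :: "'n \<Rightarrow> (complex^'n \<Rightarrow> complex) \<Rightarrow> complex^'n \<Rightarrow> complex" where
  "pd_z k F z = d_z (\<lambda>t. F (z + t *s axis k 1)) 0"

definition pd_zbar :: "'n \<Rightarrow> (complex^'n \<Rightarrow> complex) \<Rightarrow> complex^'n \<Rightarrow> complex" where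
  "pd_zbar k F z = d_zbar (\<lambda>t. F (z + t *s axis k 1)) 0"

text \<open>Polarisation: the Hermitian form, linear in \<open>V\<close> and antilinear in \<open>W\<close>, whose value at
  \<open>(V, V)\<close> is \<open>\<phi> z V\<close>.\<close>

definition herm_form ::
    "(complex^'n \<Rightarrow> complex^'n \<Rightarrow> real) \<Rightarrow> complex^'n \<Rightarrow> complex^'n \<Rightarrow> complex^'n \<Rightarrow> complex" where
  "herm_form \<phi> z V W =
     (of_real (\<phi> z (V + W)) - of_real (\<phi> z (V - W))
       + \<i> * of_real (\<phi> z (V + \<i> *s W)) - \<i> * of_real (\<phi> z (V - \<i> *s W))) / 4"

text \<open>\<open>metric_coeff \<phi> i j z\<close> is \<open>g\<close> with lower indices \<open>i\<close> and \<open>j\<close>-bar.\<close>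

definition metric_coeff ::
    "(complex^'n \<Rightarrow> complex^'n \<Rightarrow> real) \<Rightarrow> 'n \<Rightarrow> 'n \<Rightarrow> complex^'n \<Rightarrow> complex" where
  "metric_coeff \<phi> i j z = herm_form \<phi> z (axis i 1) (axis j 1)"

text \<open>The component of the inverse metric with upper indices \<open>a\<close> and \<open>b\<close>-bar; it satisfies
  \<open>(\<Sum>b. metric_coeff \<phi> i b z * metric_inv_coeff \<phi> a b z) = (if i = a then 1 else 0)\<close>, whence the
  transposed indices.\<close>

definition metric_inv_coeff ::
    "(complex^'n \<Rightarrow> complex^'n \<Rightarrow> real) \<Rightarrow> 'n \<Rightarrow> 'n \<Rightarrow> complex^'n \<Rightarrow> complex" where
  "metric_inv_coeff \<phi> a b z = matrix_inv (\<chi> i j. metric_coeff \<phi> i j z) $ b $ a"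

text \<open>The curvature tensor of a Kaehler metric, with indices \<open>i\<close>, \<open>j\<close>-bar, \<open>k\<close>, \<open>l\<close>-bar.\<close>

definition curv_tensor ::
    "(complex^'n \<Rightarrow> complex^'n \<Rightarrow> real) \<Rightarrow> complex^'n \<Rightarrow> 'n \<Rightarrow> 'n \<Rightarrow> 'n \<Rightarrow> 'n \<Rightarrow> complex" where
  "curv_tensor \<phi> z i j k l =
     - pd_z k (pd_zbar l (metric_coeff \<phi> i j)) z
     + (\<Sum>a\<in>UNIV. \<Sum>b\<in>UNIV. metric_inv_coeff \<phi> a b z
          * pd_z k (metric_coeff \<phi> i b) z * pd_zbar l (metric_coeff \<phi> a j) z)"

text \<open>The numerator is real. The factor 2 makes this the Gaussian curvature in complex dimension one:
  for \<open>h |dT|\<^sup>2\<close> the curvature tensor is \<open>- (h * d_z (d_zbar h) - d_z h * d_zbar h) / h\<close>.\<close>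

definition hol_sect_curv ::
    "(complex^'n \<Rightarrow> complex^'n \<Rightarrow> real) \<Rightarrow> complex^'n \<Rightarrow> complex^'n \<Rightarrow> real" where
  "hol_sect_curv \<phi> p V =
     2 * Re (\<Sum>i\<in>UNIV. \<Sum>j\<in>UNIV. \<Sum>k\<in>UNIV. \<Sum>l\<in>UNIV.
               curv_tensor \<phi> p i j k l * V $ i * cnj (V $ j) * V $ k * cnj (V $ l))
       / (\<phi> p V)\<^sup>2"

definition hol_sect_curv_sup ::
    "(complex^'n \<Rightarrow> complex^'n \<Rightarrow> real) \<Rightarrow> complex^'n \<Rightarrow> real" where
  "hol_sect_curv_sup \<phi> p = (SUP V\<in>{V. V \<noteq> 0}. hol_sect_curv \<phi> p V)"

section \<open>Vector fields and curvature of leaves\<close>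

definition nonsingular_holo_vf :: "(complex^'n) set \<Rightarrow> (complex^'n \<Rightarrow> complex^'n) \<Rightarrow> bool" where
  "nonsingular_holo_vf U X \<longleftrightarrow>
     open U \<and> (\<forall>i. holo_on (\<lambda>z. X z $ i) U) \<and> (\<forall>z\<in>U. X z \<noteq> 0)"

text \<open>\<open>Z\<close> is a holomorphic integral curve of \<open>X\<close> in \<open>W\<close>: the Frechet derivative \<open>t \<mapsto> t *s X (Z T)\<close>
  is complex linear, so it encodes both holomorphy and the equation \<open>Z' = X \<circ> Z\<close>.\<close>

definition integral_curve ::
    "(complex^'n) set \<Rightarrow> (complex^'n \<Rightarrow> complex^'n) \<Rightarrow> real \<Rightarrow> (complex \<Rightarrow> complex^'n) \<Rightarrow> bool" where
  "integral_curve W X \<epsilon> Z \<longleftrightarrow> Z ` ball 0 \<epsilon> \<subseteq> W \<and>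
     (\<forall>T\<in>ball 0 \<epsilon>. (Z has_derivative (\<lambda>t. t *s X (Z T))) (at T))"

text \<open>\<open>W\<close> is the common domain of the vector field and the metric. The value does not depend on the
  integral curve, whose germ at 0 is unique.\<close>

definition leaf_curvature ::
    "(complex^'n \<Rightarrow> complex^'n \<Rightarrow> real) \<Rightarrow> (complex^'n) set \<Rightarrow> (complex^'n \<Rightarrow> complex^'n)
      \<Rightarrow> complex^'n \<Rightarrow> real" where
  "leaf_curvature \<phi> W X z = (THE \<kappa>. \<exists>\<epsilon>>0. \<exists>Z. integral_curve W X \<epsilon> Z \<and> Z 0 = z \<and>
     \<kappa> = gauss_curvature (\<lambda>T. \<phi> (Z T) (X (Z T))) 0)"

end

theory Submission
  imports Defs "HOL-Real_Asymp.Real_Asymp"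
begin

text \<open>
  Write \<open>\<eta> = weight (|f|\<^sup>2)\<close>, so that the metric has coefficients \<open>\<delta>\<^sub>i\<^sub>j + \<eta> f\<^sub>i cnj f\<^sub>j\<close>. Its inverse is
  again a rank one perturbation of the identity, and on the kernel of \<open>df\<close> the curvature tensor reduces
  to a nonpositive multiple of \<open>|\<alpha> V V|\<^sup>2\<close> for a quadratic form \<open>\<alpha>\<close>.

  Along the curve \<open>Z T = z + T e + (T\<^sup>2 / 2) k\<close> with \<open>k\<close> orthogonal to \<open>e\<close>, the metric pulls back to
  \<open>\<eta>(F T) |F' T|\<^sup>2 + |e|\<^sup>2 + |k|\<^sup>2 |T|\<^sup>2\<close> with \<open>F = f \<circ> Z\<close>. Such curves are integral curves of explicit
  vector fields. Taking \<open>e\<close> to be the conjugate gradient of \<open>f\<close> and \<open>k\<close> a large vector in the kernel of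
  \<open>df\<close>, the term \<open>|k|\<^sup>2 |T|\<^sup>2\<close> makes the curvature nonpositive whatever \<open>\<eta>\<close> is. At a zero of \<open>f\<close>, a
  constant field \<open>e = axis i 1\<close> (with \<open>k = 0\<close>) suffices, because \<open>\<eta>\<close> is asymptotic to
  \<open>1 / (|w| ln |w|\<^sup>2)\<^sup>2\<close>, the Poincare metric of the punctured disc scaled to curvature \<open>-4\<close>.

  That \<open>f\<close> vanishes precisely on the support of its divisor needs an irreducible component through
  every zero; it comes from Zorn's lemma, since the intersection of a chain of prime ideals is prime.
\<close>

unbundle no fps_syntax

section \<open>The complex differential of a holomorphic function\<close>

lemma bounded_linear_scalar_vec: "bounded_linear (\<lambda>t::complex. t *s (v::complex^'n))"
  by (auto simp: linear_conv_bounded_linear[symmetric] vec_eq_iff algebra_simps intro!: linearI)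

lemma has_derivative_line: "((\<lambda>t. z + t *s v) has_derivative (\<lambda>t::complex. t *s (v::complex^'n))) (at T)"
  using bounded_linear_imp_has_derivative[OF bounded_linear_scalar_vec]
  by (auto intro!: derivative_eq_intros)

text \<open>A complex linear map is determined by its values on the basis vectors
  \<open>axis i 1\<close>, and restriction to the coordinate lines identifies these values with
  \<open>pderiv_z\<close>.\<close>

lemma holo_on_has_derivative:
  fixes F :: "complex^'n \<Rightarrow> complex"
  assumes "holo_on F U" "z \<in> U"
  shows "(F has_derivative cdiff F z) (at z)"
proof -
  obtain L where L: "(F has_derivative L) (at z)" "\<And>c v. L (c *s v) = c * L v"
    using assms by (auto simp: holo_on_def)
  have lin: "linear L" using L(1) by (simp add: has_derivative_linear)
  have pd: "pderiv_z i F z = L (axis i 1)" for i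
  proof -
    have "((\<lambda>t. F (z + t *s axis i 1)) has_derivative (\<lambda>t. L (t *s axis i 1))) (at 0)"
      by (rule has_derivative_compose[OF has_derivative_line]) (use L in simp)
    then have "((\<lambda>t. F (z + t *s axis i 1)) has_field_derivative L (axis i 1)) (at 0)"
      by (simp add: has_field_derivative_def L(2) mult_commute_abs)
    then show ?thesis
      unfolding pderiv_z_def by (rule DERIV_imp_deriv)
  qed
  have "L v = cdiff F z v" for v
  proof -
    have "L v = L (\<Sum>i\<in>UNIV. (v$i) *s axis i 1)" by (simp add: basis_expansion)
    also have "\<dots> = cdiff F z v"
      by (simp add: linear_sum[OF lin] L(2) cdiff_def pd mult.commute)
    finally show ?thesis .
  qed
  then have "L = cdiff F z" by blast
  with L show ?thesis by simp
qed

lemma cdiff_scale: "cdiff F z (c *s v) = c * cdiff F z v"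
  by (simp add: cdiff_def sum_distrib_left mult_ac)

lemma cdiff_add: "cdiff F z (v + w) = cdiff F z v + cdiff F z w"
  by (simp add: cdiff_def sum.distrib algebra_simps)

lemma cdiff_axis: "cdiff F z (axis i 1) = pderiv_z i F z"
proof -
  have "cdiff F z (axis i 1) = (\<Sum>k\<in>UNIV. if k = i then pderiv_z k F z else 0)"
    unfolding cdiff_def by (rule sum.cong) (auto simp: axis_def)
  then show ?thesis by simp
qed

lemma holo_on_chain:
  assumes "holo_on F U" "Z T \<in> U" "(Z has_derivative (\<lambda>t. t *s V)) (at T)"
  shows "((\<lambda>T. F (Z T)) has_field_derivative cdiff F (Z T) V) (at T)"
proof -
  have "((\<lambda>T. F (Z T)) has_derivative (\<lambda>t. cdiff F (Z T) (t *s V))) (at T)"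
    using has_derivative_compose[OF assms(3) holo_on_has_derivative[OF assms(1,2)]] .
  then show ?thesis
    by (simp add: has_field_derivative_def cdiff_scale mult_commute_abs)
qed

lemma holo_on_line:
  assumes "holo_on F U" "z + T *s v \<in> U"
  shows "((\<lambda>t. F (z + t *s v)) has_field_derivative cdiff F (z + T *s v) v) (at T)"
  using holo_on_chain[OF assms has_derivative_line] .

lemma entire_line:
  assumes "holo_on F UNIV"
  shows "(\<lambda>t. F (z + t *s v)) holomorphic_on S"
proof (rule holomorphic_onI)
  fix T
  show "(\<lambda>t. F (z + t *s v)) field_differentiable at T within S"
    using holo_on_line[OF assms UNIV_I] field_differentiable_at_within field_differentiable_def by blast
qed

lemma holo_on_continuous: "holo_on F U \<Longrightarrow> continuous_on U F"
  by (meson continuous_at_imp_continuous_on has_derivative_continuous holo_on_has_derivative)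

text \<open>Supplies the functions \<open>z $ i - p $ i\<close> that cut out a point.\<close>

lemma holo_on_affine:
  fixes a :: "complex^'n"
  shows "holo_on (\<lambda>z. b + (\<Sum>i\<in>UNIV. a $ i * z $ i)) UNIV"
  unfolding holo_on_def
proof (intro conjI ballI)
  fix z :: "complex^'n"
  have "((\<lambda>z. b + (\<Sum>i\<in>UNIV. a $ i * z $ i)) has_derivative (\<lambda>v. 0 + (\<Sum>i\<in>UNIV. a $ i * v $ i))) (at z)"
    by (intro has_derivative_add has_derivative_const has_derivative_sum has_derivative_mult_right
        bounded_linear_imp_has_derivative bounded_linear_vec_nth)
  then show "\<exists>L. ((\<lambda>z. b + (\<Sum>i\<in>UNIV. a $ i * z $ i)) has_derivative L) (at z) \<and> (\<forall>c v. L (c *s v) = c * L v)"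
    by (intro exI[of _ "\<lambda>v. 0 + (\<Sum>i\<in>UNIV. a $ i * v $ i)"] conjI) (auto simp: sum_distrib_left mult_ac)
qed auto

section \<open>The support of the divisor of an entire function\<close>

lemma analytic_subset_zeros: "holo_on g UNIV \<Longrightarrow> analytic_subset {z. g z = 0}"
  unfolding analytic_subset_def by (rule exI[of _ "{g}"]) auto

lemma analytic_subset_Int:
  "analytic_subset A \<Longrightarrow> analytic_subset B \<Longrightarrow> analytic_subset (A \<inter> B)"
  unfolding analytic_subset_def by (elim exE, rule_tac x = "S \<union> Sa" in exI) auto

lemma analytic_subset_separate:
  assumes "analytic_subset B" "z \<notin> B"
  obtains g where "holo_on g UNIV" "\<forall>x\<in>B. g x = 0" "g z \<noteq> 0"
  using assms unfolding analytic_subset_def by auto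

text \<open>Irreducibility of \<open>A\<close> means that the ideal of entire functions vanishing on \<open>A\<close> is prime.\<close>

lemma irreducible_analytic_prime:
  assumes "irreducible_analytic A" "holo_on g UNIV" "holo_on h UNIV" "\<forall>x\<in>A. g x * h x = 0"
  shows "(\<forall>x\<in>A. g x = 0) \<or> (\<forall>x\<in>A. h x = 0)"
proof -
  let ?B = "A \<inter> {z. g z = 0}" and ?C = "A \<inter> {z. h z = 0}"
  have "analytic_subset ?B" "analytic_subset ?C" "A = ?B \<union> ?C"
    using assms by (auto intro!: analytic_subset_Int analytic_subset_zeros simp: irreducible_analytic_def)
  then have "A = ?B \<or> A = ?C"
    using assms(1) unfolding irreducible_analytic_def by meson
  then show ?thesis by blast
qed

text \<open>Points of \<open>A\<close> outside \<open>B\<close> and outside \<open>C\<close> yield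
  entire functions that vanish on \<open>B\<close> and on \<open>C\<close> respectively, but not on
  all of \<open>A\<close>. Their product vanishes on \<open>B \<union> C\<close>, contrary to
  primality.\<close>

lemma irreducible_analyticI:
  assumes "analytic_subset A" "A \<noteq> {}"
    and prime: "\<And>g h. holo_on g UNIV \<Longrightarrow> holo_on h UNIV \<Longrightarrow> \<forall>x\<in>A. g x * h x = 0 \<Longrightarrow>
      (\<forall>x\<in>A. g x = 0) \<or> (\<forall>x\<in>A. h x = 0)"
  shows "irreducible_analytic A"
  unfolding irreducible_analytic_def
proof (intro conjI allI impI assms; elim conjE)
  fix B C assume BC: "analytic_subset B" "analytic_subset C" "A = B \<union> C"
  show "A = B \<or> A = C"
  proof (rule ccontr)
    assume "\<not> ?thesis"
    then obtain x y where xy: "x \<in> A" "x \<notin> B" "y \<in> A" "y \<notin> C" using BC by blast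
    obtain g where g: "holo_on g UNIV" "\<forall>x\<in>B. g x = 0" "g x \<noteq> 0"
      using analytic_subset_separate[OF BC(1) xy(2)] .
    obtain h where h: "holo_on h UNIV" "\<forall>x\<in>C. h x = 0" "h y \<noteq> 0"
      using analytic_subset_separate[OF BC(2) xy(4)] .
    have "\<forall>x\<in>A. g x * h x = 0" using g h BC by auto
    then show False using prime[OF g(1) h(1)] xy g h by blast
  qed
qed

text \<open>The ideal of a point is prime because the complex numbers have no zero divisors. In the
  application of Zorn's lemma this set bounds the empty chain.\<close>

lemma irreducible_analytic_singleton: "irreducible_analytic {p::complex^'n}"
proof (rule irreducible_analyticI)
  have "{p} = {z. \<forall>g\<in>range (\<lambda>i z. - p $ i + (\<Sum>j\<in>UNIV. axis i 1 $ j * z $ j)). g z = 0}"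
  proof -
    have "(\<Sum>j\<in>UNIV. axis i 1 $ j * z $ j) = z $ i" for i and z :: "complex^'n"
    proof -
      have "(\<Sum>j\<in>UNIV. axis i 1 $ j * z $ j) = (\<Sum>j\<in>UNIV. if j = i then z $ j else 0)"
        by (rule sum.cong) (auto simp: axis_def)
      then show ?thesis by simp
    qed
    then show ?thesis by (auto simp: vec_eq_iff)
  qed
  moreover have "\<forall>g\<in>range (\<lambda>i z. - p $ i + (\<Sum>j\<in>UNIV. axis i 1 $ j * z $ j)). holo_on g UNIV"
    using holo_on_affine by blast
  ultimately show "analytic_subset {p}"
    unfolding analytic_subset_def by blast
qed auto

text \<open>The analytic hull of the union of a chain of irreducible sets is irreducible: the
  intersection of a chain of prime ideals is prime. Hence Zorn's lemma applies.\<close>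

lemma irreducible_component_through:
  assumes "analytic_subset A" "p \<in> A"
  obtains V where "irreducible_component A V" "p \<in> V"
proof -
  let ?\<A> = "{W. irreducible_analytic W \<and> W \<subseteq> A \<and> p \<in> W}"
  have "\<exists>M\<in>?\<A>. \<forall>X\<in>?\<A>. M \<subseteq> X \<longrightarrow> X = M"
  proof (rule subset_Zorn)
    fix C assume chain: "subset.chain ?\<A> C"
    show "\<exists>U\<in>?\<A>. \<forall>X\<in>C. X \<subseteq> U"
    proof (cases "C = {}")
      case True
      then show ?thesis using irreducible_analytic_singleton[of p] assms by auto
    next
      case False
      define H where "H = {z. \<forall>g. holo_on g UNIV \<and> (\<forall>x\<in>\<Union>C. g x = 0) \<longrightarrow> g z = 0}"
      have sub: "X \<subseteq> H" if "X \<in> C" for X using that by (auto simp: H_def)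
      have C: "irreducible_analytic X" "X \<subseteq> A" "p \<in> X" if "X \<in> C" for X
        using that chain by (auto simp: subset.chain_def)
      have vanish: "(\<forall>x\<in>H. g x = 0) \<longleftrightarrow> (\<forall>X\<in>C. \<forall>x\<in>X. g x = 0)" if "holo_on g UNIV" for g
        using that sub by (auto simp: H_def)
      have "irreducible_analytic H"
      proof (rule irreducible_analyticI)
        show "analytic_subset H" unfolding analytic_subset_def H_def
          by (rule exI[of _ "{g. holo_on g UNIV \<and> (\<forall>x\<in>\<Union>C. g x = 0)}"]) auto
        show "H \<noteq> {}" using False sub C by blast
        fix g h assume gh: "holo_on g UNIV" "holo_on h UNIV" "\<forall>x\<in>H. g x * h x = 0"
        show "(\<forall>x\<in>H. g x = 0) \<or> (\<forall>x\<in>H. h x = 0)"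
        proof (rule ccontr)
          assume "\<not> ?thesis"
          then obtain X Y where XY: "X \<in> C" "Y \<in> C" "\<not> (\<forall>x\<in>X. g x = 0)" "\<not> (\<forall>x\<in>Y. h x = 0)"
            unfolding vanish[OF gh(1)] vanish[OF gh(2)] by blast
          \<comment> \<open>\<open>g\<close> and \<open>h\<close> may fail to vanish on different
            members of the chain; the larger member \<open>Z\<close> carries both failures, against
            its primality.\<close>
          have "X \<subseteq> Y \<or> Y \<subseteq> X" using XY chain by (auto simp: subset.chain_def)
          then obtain Z where Z: "Z \<in> C" "X \<subseteq> Z" "Y \<subseteq> Z" using XY by blast
          have "\<forall>x\<in>Z. g x * h x = 0" using gh(3) sub Z by blast
          then show False
            using irreducible_analytic_prime[OF C(1)[OF Z(1)] gh(1,2)] XY Z by blast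
        qed
      qed
      moreover have "H \<subseteq> A"
      proof
        fix z assume "z \<in> H"
        show "z \<in> A"
        proof (rule ccontr)
          assume "z \<notin> A"
          then obtain g where "holo_on g UNIV" "\<forall>x\<in>A. g x = 0" "g z \<noteq> 0"
            using analytic_subset_separate[OF assms(1)] by blast
          then show False using \<open>z \<in> H\<close> C(2) by (fastforce simp: H_def)
        qed
      qed
      moreover have "p \<in> H" using False sub C by blast
      ultimately show ?thesis using sub by blast
    qed
  qed
  then obtain M where M: "M \<in> ?\<A>" "\<forall>X\<in>?\<A>. M \<subseteq> X \<longrightarrow> X = M"
    by (rule bexE)
  \<comment> \<open>An irreducible set containing \<open>M\<close> also contains \<open>p\<close>,
    so maximality among the sets through \<open>p\<close> is maximality among all.\<close>
  have "irreducible_component A M"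
    unfolding irreducible_component_def using M by auto
  then show ?thesis using M that by auto
qed

text \<open>If all derivatives along the line from \<open>q\<close> to \<open>z\<close> vanished,
  the identity theorem would force \<open>f z = 0\<close>. So the \<open>LEAST\<close> in
  \<open>order_at\<close> is attained, and not at 0, because the derivative of order 0 is
  \<open>f q\<close>.\<close>

lemma order_at_pos:
  assumes "holo_on f UNIV" "f z \<noteq> 0" "f q = 0"
  shows "order_at f q \<noteq> 0"
proof -
  let ?P = "\<lambda>m. \<exists>v. (deriv ^^ m) (\<lambda>t. f (q + t *s v)) 0 \<noteq> 0"
  have "\<exists>m. ?P m"
  proof (rule ccontr)
    assume "\<nexists>m. ?P m"
    then have zero: "(deriv ^^ m) (\<lambda>t. f (q + t *s (z - q))) 0 = 0" for m by blast
    have "(\<lambda>t. f (q + t *s (z - q))) 1 = 0"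
      by (rule holomorphic_fun_eq_0_on_connected[OF entire_line[OF assms(1)]
            open_UNIV connected_UNIV zero UNIV_I UNIV_I])
    then show False using assms by simp
  qed
  then have "?P (order_at f q)" unfolding order_at_def by (rule LeastI_ex)
  then obtain v where v: "(deriv ^^ order_at f q) (\<lambda>t. f (q + t *s v)) 0 \<noteq> 0" ..
  show ?thesis
  proof
    assume "order_at f q = 0"
    then have "f (q + 0 *s v) \<noteq> 0" using v by (simp del: vector_smult_lzero)
    then show False using assms(3) by simp
  qed
qed

lemma div_support_Div_of:
  fixes f :: "complex^'n::finite \<Rightarrow> complex"
  assumes "holo_on f UNIV" "\<exists>z. f z \<noteq> 0"
  shows "div_support (Div_of f) = {z. f z = 0}"
proof
  show "div_support (Div_of f) \<subseteq> {z. f z = 0}"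
    by (auto simp: div_support_def Div_of_def irreducible_component_def split: if_splits)
  show "{z. f z = 0} \<subseteq> div_support (Div_of f)"
  proof
    fix p assume "p \<in> {z. f z = 0}"
    then obtain V where V: "irreducible_component {z. f z = 0} V" "p \<in> V"
      using irreducible_component_through[OF analytic_subset_zeros[OF assms(1)]] by blast
    \<comment> \<open>An infimum of naturals over a nonempty set is attained, here at a zero of
      \<open>f\<close>, where the order is positive.\<close>
    then have "order_along V f \<in> order_at f ` V"
      unfolding order_along_def by (intro Inf_nat_def1) auto
    then have "order_along V f \<noteq> 0"
      using order_at_pos[OF assms(1)] assms(2) V by (force simp: irreducible_component_def)
    then show "p \<in> div_support (Div_of f)"
      using V by (auto simp: div_support_def Div_of_def intro!: exI[of _ V])
  qed
qed

section \<open>Wirtinger derivatives\<close>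

text \<open>Every real linear map of the plane has this form with unique coefficients, so
  \<open>a\<close> and \<open>b\<close> are the two Wirtinger derivatives and the rules below track
  both at once.\<close>

definition has_wirtinger :: "(complex \<Rightarrow> complex) \<Rightarrow> complex \<Rightarrow> complex \<Rightarrow> complex \<Rightarrow> bool" where
  "has_wirtinger F a b T \<longleftrightarrow> (F has_derivative (\<lambda>t. a * t + b * cnj t)) (at T)"

lemma has_wirtinger_imp:
  assumes "has_wirtinger F a b T"
  shows "d_z F T = a" "d_zbar F T = b"
proof -
  have "frechet_derivative F (at T) = (\<lambda>t. a * t + b * cnj t)"
    using assms unfolding has_wirtinger_def by (metis frechet_derivative_at)
  then show "d_z F T = a" "d_zbar F T = b"
    by (simp_all add: d_z_def d_zbar_def algebra_simps flip: mult.assoc)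
qed

lemma has_wirtinger_eq:
  "has_wirtinger F a b T \<Longrightarrow> a = a' \<Longrightarrow> b = b' \<Longrightarrow> has_wirtinger F a' b' T"
  by simp

lemma has_wirtinger_cong_open:
  assumes "has_wirtinger F a b T" "open S" "T \<in> S" "\<And>x. x \<in> S \<Longrightarrow> F x = G x"
  shows "has_wirtinger G a b T"
  using assms has_derivative_transform_within_open unfolding has_wirtinger_def by blast

lemma has_wirtinger_const: "has_wirtinger (\<lambda>_. c) 0 0 T"
  by (simp add: has_wirtinger_def)

lemma has_wirtinger_DERIV: "(F has_field_derivative a) (at T) \<Longrightarrow> has_wirtinger F a 0 T"
  by (simp add: has_wirtinger_def has_field_derivative_def)

lemma has_wirtinger_cnj:
  "has_wirtinger F a b T \<Longrightarrow> has_wirtinger (\<lambda>x. cnj (F x)) (cnj b) (cnj a) T"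
  unfolding has_wirtinger_def by (drule has_derivative_cnj) (simp add: add.commute)

lemma has_wirtinger_add:
  "has_wirtinger F a b T \<Longrightarrow> has_wirtinger G c d T \<Longrightarrow> has_wirtinger (\<lambda>x. F x + G x) (a + c) (b + d) T"
  unfolding has_wirtinger_def by (drule (1) has_derivative_add) (simp add: algebra_simps)

lemma has_wirtinger_mult:
  "has_wirtinger F a b T \<Longrightarrow> has_wirtinger G c d T \<Longrightarrow>
    has_wirtinger (\<lambda>x. F x * G x) (a * G T + F T * c) (b * G T + F T * d) T"
  unfolding has_wirtinger_def by (drule (1) has_derivative_mult) (simp add: algebra_simps)

lemma has_wirtinger_real_compose:
  fixes s :: "complex \<Rightarrow> real"
  assumes s: "has_wirtinger (\<lambda>x. of_real (s x)) a b T"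
    and e: "(e has_real_derivative e') (at (s T))"
  shows "has_wirtinger (\<lambda>x. of_real (e (s x))) (of_real e' * a) (of_real e' * b) T"
proof -
  have 1: "(s has_derivative (\<lambda>t. Re (a * t + b * cnj t))) (at T)"
    using has_derivative_Re[OF s[unfolded has_wirtinger_def]] by simp
  \<comment> \<open>Both maps are derivatives at \<open>T\<close> of the same function, so they
    agree and the differential of \<open>s\<close> takes real values.\<close>
  have "(\<lambda>t. complex_of_real (Re (a * t + b * cnj t))) = (\<lambda>t. a * t + b * cnj t)"
    using has_derivative_of_real[OF 1] s[unfolded has_wirtinger_def] by (rule has_derivative_unique)
  then have real: "complex_of_real (Re (a * t + b * cnj t)) = a * t + b * cnj t" for t
    by (rule fun_cong)
  have "((\<lambda>x. e (s x)) has_derivative (\<lambda>t. e' * Re (a * t + b * cnj t))) (at T)"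
    using has_derivative_compose[OF 1 e[unfolded has_field_derivative_def]] .
  then have "((\<lambda>x. complex_of_real (e (s x))) has_derivative
      (\<lambda>t. of_real e' * complex_of_real (Re (a * t + b * cnj t)))) (at T)"
    by (drule_tac has_derivative_of_real) simp
  then show ?thesis
    unfolding has_wirtinger_def real by (simp add: algebra_simps)
qed

lemma of_real_cmod_square: "(complex_of_real (cmod z))\<^sup>2 = z * cnj z"
  by (simp add: complex_norm_square flip: of_real_power)

lemma has_wirtinger_norm_compose:
  assumes F: "(F has_field_derivative F') (at T)"
    and e: "(e has_real_derivative e') (at ((cmod (F T))\<^sup>2))"
  shows "has_wirtinger (\<lambda>x. of_real (e ((cmod (F x))\<^sup>2)))
           (of_real e' * (F' * cnj (F T))) (of_real e' * (F T * cnj F')) T"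
proof (rule has_wirtinger_real_compose[where s = "\<lambda>x. (cmod (F x))\<^sup>2", OF _ e])
  have "has_wirtinger (\<lambda>x. F x * cnj (F x)) (F' * cnj (F T)) (F T * cnj F') T"
    using has_wirtinger_mult[OF has_wirtinger_DERIV[OF F] has_wirtinger_cnj[OF has_wirtinger_DERIV[OF F]]]
    by simp
  then show "has_wirtinger (\<lambda>x. complex_of_real ((cmod (F x))\<^sup>2)) (F' * cnj (F T)) (F T * cnj F') T"
    by (simp add: of_real_cmod_square)
qed

section \<open>The weight of the Grauert metric\<close>

definition weight :: "real \<Rightarrow> real" where
  "weight t = 1 + t * (u_fun t)\<^sup>2"

lemma weight_ge_1: "t \<ge> 0 \<Longrightarrow> weight t \<ge> 1"
  by (simp add: weight_def)

lemma DERIV_Re_of_real: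
  assumes "(C has_field_derivative c) (at (complex_of_real t))"
  shows "((\<lambda>x. Re (C (of_real x))) has_real_derivative Re c) (at t)"
proof -
  have "((\<lambda>x. Re (C (of_real x))) has_derivative (\<lambda>x. Re (c * of_real x))) (at t)"
    using has_derivative_Re[OF has_derivative_compose[OF has_derivative_of_real[OF has_derivative_ident]
        assms[unfolded has_field_derivative_def], of UNIV]] by simp
  then show ?thesis by (simp add: has_field_derivative_def)
qed

text \<open>The singularity of \<open>u\<close> at 1 is that of \<open>(z - 1) / Ln z\<close>, whose reciprocal is a removable
  difference quotient.\<close>

lemma weight_holomorphic_extension:
  obtains C where "C holomorphic_on - \<real>\<^sub>\<le>\<^sub>0" "\<And>t. t > 0 \<Longrightarrow> C (of_real t) = of_real (weight t)"
proof (rule that)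
  let ?g = "\<lambda>z. if z = 1 then deriv Ln 1 else (Ln z - Ln 1) / (z - 1)"
  have g: "?g holomorphic_on - \<real>\<^sub>\<le>\<^sub>0"
    by (rule pole_lemma_open) (auto intro!: holomorphic_intros)
  have D: "deriv Ln 1 = 1"
    by (rule DERIV_imp_deriv) (auto intro!: derivative_eq_intros)
  have nz: "?g z \<noteq> 0" if "z \<in> - \<real>\<^sub>\<le>\<^sub>0" for z
  proof (cases "z = 1")
    case False
    have "z \<noteq> 0" using that by auto
    then have "Ln z \<noteq> 0" using False by (metis exp_Ln exp_zero)
    then show ?thesis using False by simp
  qed (simp add: D)
  \<comment> \<open>For \<open>t > 0\<close> one has \<open>u_fun t = 1 / (t * ?g t)\<close>, so
    \<open>t * (u_fun t)^2\<close> becomes \<open>1 / (t * (?g t)^2)\<close>.\<close>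
  show "(\<lambda>z. 1 + 1 / (z * (?g z)\<^sup>2)) holomorphic_on - \<real>\<^sub>\<le>\<^sub>0"
    using nz by (intro holomorphic_intros g) auto
  fix t :: real assume t: "t > 0"
  show "1 + 1 / (complex_of_real t * (?g (of_real t))\<^sup>2) = of_real (weight t)"
  proof (cases "t = 1")
    case True
    then show ?thesis by (simp add: D weight_def u_fun_def)
  next
    case False
    then have "ln t \<noteq> 0" using t by simp
    moreover have "Ln (complex_of_real t) = of_real (ln t)" using t by (simp add: Ln_of_real)
    ultimately show ?thesis using False t
      by (simp add: weight_def u_fun_def power2_eq_square divide_simps)
  qed
qed

text \<open>The holomorphic extension and its derivative, restricted to the positive axis, give
  differentiability also at \<open>t = 1\<close>, where \<open>u_fun\<close> is defined by
  cases.\<close>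

lemma weight_DERIV:
  assumes "t > 0"
  shows "(weight has_real_derivative deriv weight t) (at t)"
    and "(deriv weight has_real_derivative deriv (deriv weight) t) (at t)"
proof -
  obtain C where C: "C holomorphic_on - \<real>\<^sub>\<le>\<^sub>0" "\<And>t. t > 0 \<Longrightarrow> C (of_real t) = of_real (weight t)"
    using weight_holomorphic_extension by blast
  have mem: "complex_of_real t \<in> - \<real>\<^sub>\<le>\<^sub>0" if "t > 0" for t using that by auto
  have op: "open (- \<real>\<^sub>\<le>\<^sub>0 :: complex set)" by auto
  have 1: "(weight has_real_derivative Re (deriv C (of_real t))) (at t)" if "t > 0" for t
    by (rule has_field_derivative_transform_within_open[OF
          DERIV_Re_of_real[OF holomorphic_derivI[OF C(1) op mem[OF that]]], of "{0<..}"])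
       (use that C(2) in auto)
  then have d: "deriv weight t = Re (deriv C (of_real t))" if "t > 0" for t
    using that by (auto intro: DERIV_imp_deriv)
  show "(weight has_real_derivative deriv weight t) (at t)" using 1 d assms by simp
  have "(deriv weight has_real_derivative Re (deriv (deriv C) (of_real t))) (at t)"
    by (rule has_field_derivative_transform_within_open[OF
          DERIV_Re_of_real[OF holomorphic_derivI[OF holomorphic_deriv[OF C(1) op] op mem[OF assms]]], of "{0<..}"])
       (use assms d in auto)
  then show "(deriv weight has_real_derivative deriv (deriv weight) t) (at t)"
    by (metis DERIV_imp_deriv)
qed

section \<open>Curvature of a leaf\<close>

text \<open>In terms of \<open>\<eta> w = weight (|w|\<^sup>2)\<close>, the mixed second derivative of \<open>\<eta>\<close> is \<open>laplace_weight\<close>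
  and \<open>\<eta>\<close> times it minus the squared gradient is \<open>weight_disc\<close>.\<close>

definition laplace_weight :: "real \<Rightarrow> real" where
  "laplace_weight t = deriv weight t + t * deriv (deriv weight) t"

definition weight_disc :: "real \<Rightarrow> real" where
  "weight_disc t = weight t * laplace_weight t - t * (deriv weight t)\<^sup>2"

text \<open>If \<open>R = Q = 0\<close>, the factor \<open>|F'|^2\<close> has harmonic logarithm
  where \<open>F'\<close> is nonzero, so the numerator reduces to \<open>|a|^6\<close> times
  \<open>weight_disc\<close>. In general \<open>R\<close> multiplies the mixed second derivative of
  the term \<open>weight (|F|^2) * |F'|^2\<close>, and \<open>Q\<close> multiplies the value of
  \<open>h\<close> at 0.\<close>

lemma gauss_curvature_pullback:
  fixes F :: "complex \<Rightarrow> complex" and R Q :: real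
  assumes F: "F holomorphic_on ball 0 \<epsilon>" and "\<epsilon> > 0" and nz: "\<And>T. T \<in> ball 0 \<epsilon> \<Longrightarrow> F T \<noteq> 0"
    and h: "\<And>T. T \<in> ball 0 \<epsilon> \<Longrightarrow>
        h T = weight ((cmod (F T))\<^sup>2) * (cmod (deriv F T))\<^sup>2 + R + Q * (cmod T)\<^sup>2"
    and "R > 0"
  defines "a \<equiv> deriv F 0" and "b \<equiv> deriv (deriv F) 0" and "t \<equiv> (cmod (F 0))\<^sup>2"
  shows "gauss_curvature h 0 =
    - 2 * ((cmod a) ^ 6 * weight_disc t
        + R * (laplace_weight t * (cmod a) ^ 4 + 2 * deriv weight t * Re (cnj (F 0) * a\<^sup>2 * cnj b)
               + weight t * (cmod b)\<^sup>2)
        + (weight t * (cmod a)\<^sup>2 + R) * Q) / (weight t * (cmod a)\<^sup>2 + R) ^ 3"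
proof -
  let ?S = "ball (0::complex) \<epsilon>"
  let ?t = "\<lambda>T. (cmod (F T))\<^sup>2"
  let ?G = "\<lambda>T. complex_of_real (weight (?t T)) * (deriv F T * cnj (deriv F T)) + (of_real R + of_real Q * (T * cnj T))"
  let ?B = "\<lambda>T. of_real (deriv weight (?t T)) * (F T * cnj (deriv F T)) * (deriv F T * cnj (deriv F T))
      + of_real (weight (?t T)) * (deriv F T * cnj (deriv (deriv F) T)) + of_real Q * T"
  let ?A = "\<lambda>T. of_real (deriv weight (?t T)) * (deriv F T * cnj (F T)) * (deriv F T * cnj (deriv F T))
      + of_real (weight (?t T)) * (deriv (deriv F) T * cnj (deriv F T)) + of_real Q * cnj T"
  have D1: "(F has_field_derivative deriv F T) (at T)" if "T \<in> ?S" for T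
    using holomorphic_derivI[OF F _ that] by simp
  have D2: "(deriv F has_field_derivative deriv (deriv F) T) (at T)" if "T \<in> ?S" for T
    using holomorphic_derivI[OF holomorphic_deriv[OF F] _ that] by simp
  have D3: "(deriv (deriv F) has_field_derivative deriv (deriv (deriv F)) T) (at T)" if "T \<in> ?S" for T
    using holomorphic_derivI[OF holomorphic_deriv[OF holomorphic_deriv[OF F]] _ that] by simp
  have pos: "?t T > 0" if "T \<in> ?S" for T using nz[OF that] by simp
  note W = has_wirtinger_DERIV has_wirtinger_cnj[OF has_wirtinger_DERIV] has_wirtinger_const
    has_wirtinger_add has_wirtinger_mult
  \<comment> \<open>The calculus rules compute both coefficients by resolution, and
    \<open>has_wirtinger_eq\<close> compares the results with \<open>?A\<close> and
    \<open>?B\<close>.\<close>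
  have G: "has_wirtinger ?G (?A T) (?B T) T" if T: "T \<in> ?S" for T
    by (rule has_wirtinger_eq, (rule W D1 D2 T has_wirtinger_norm_compose weight_DERIV pos DERIV_ident)+)
       (simp_all add: algebra_simps)
  have HG: "complex_of_real (h T) = ?G T" if "T \<in> ?S" for T
    by (simp add: h[OF that] of_real_cmod_square)
  have H: "has_wirtinger (\<lambda>T. complex_of_real (h T)) (?A T) (?B T) T" if T: "T \<in> ?S" for T
    by (rule has_wirtinger_cong_open[OF G[OF T] _ T]) (simp_all add: HG)
  note H0 = has_wirtinger_imp[OF H]
  have 0: "0 \<in> ?S" using \<open>\<epsilon> > 0\<close> by simp
  define E E1 E2 where "E = complex_of_real (weight t)" and "E1 = complex_of_real (deriv weight t)"
    and "E2 = complex_of_real (deriv (deriv weight) t)"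
  let ?BB = "E2 * (a * cnj (F 0)) * (F 0 * cnj a) * (a * cnj a) + E1 * (a * cnj a) * (a * cnj a)
      + E1 * (F 0 * cnj a) * (b * cnj a) + E1 * (a * cnj (F 0)) * (a * cnj b) + E * (b * cnj b) + of_real Q"
  \<comment> \<open>Only the holomorphic coefficient of \<open>?B\<close> enters the curvature; the
    other one stays unspecified.\<close>
  have "\<exists>c. has_wirtinger ?B ?BB c 0"
    unfolding E_def E1_def E2_def a_def b_def t_def
    by (rule exI, rule has_wirtinger_eq, (rule W D1 D2 D3 0 has_wirtinger_norm_compose weight_DERIV pos DERIV_ident)+)
       (simp_all add: algebra_simps)
  then obtain c where "has_wirtinger ?B ?BB c 0" ..
  \<comment> \<open>The formula for \<open>d_zbar\<close> holds on the whole ball, so it may be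
    differentiated again.\<close>
  then have "has_wirtinger (d_zbar (\<lambda>T. complex_of_real (h T))) ?BB c 0"
    by (rule has_wirtinger_cong_open[OF _ open_ball 0]) (simp add: H0)
  then have BB: "d_z (d_zbar (\<lambda>T. complex_of_real (h T))) 0 = ?BB"
    by (rule has_wirtinger_imp)
  define h0 where "h0 = weight t * (cmod a)\<^sup>2 + R"
  have h0: "h 0 = h0" using h[OF 0] by (simp add: h0_def a_def t_def)
  let ?N = "(cmod a) ^ 6 * weight_disc t
        + R * (laplace_weight t * (cmod a) ^ 4 + 2 * deriv weight t * Re (cnj (F 0) * a\<^sup>2 * cnj b)
               + weight t * (cmod b)\<^sup>2) + h0 * Q"
  have ch0: "complex_of_real h0 = E * (a * cnj a) + of_real R"
    by (simp add: h0_def E_def of_real_cmod_square)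
  have A6: "complex_of_real ((cmod a) ^ 6) = (a * cnj a) ^ 3" "complex_of_real ((cmod a) ^ 4) = (a * cnj a) ^ 2"
    by (simp_all add: of_real_cmod_square[symmetric] flip: power_mult)
  have Re2: "complex_of_real (2 * x * Re y) = of_real x * (y + cnj y)" for x y
    by (simp add: complex_add_cnj)
  have tt: "complex_of_real t = F 0 * cnj (F 0)" by (simp add: t_def of_real_cmod_square)
  define w where "w = F 0"
  let ?L = "E1 + w * cnj w * E2"
  \<comment> \<open>Over the complex numbers the identity is polynomial in \<open>a\<close>,
    \<open>b\<close>, \<open>w\<close>, their conjugates and the real constants.\<close>
  have "complex_of_real ?N = (a * cnj a) ^ 3 * (E * ?L - w * cnj w * E1\<^sup>2)
      + of_real R * (?L * (a * cnj a)\<^sup>2 + E1 * (cnj w * a\<^sup>2 * cnj b + cnj (cnj w * a\<^sup>2 * cnj b)) + E * (b * cnj b))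
      + (E * (a * cnj a) + of_real R) * of_real Q"
    unfolding of_real_add of_real_mult[of h0] of_real_mult[of "_ ^ 6"] of_real_mult[of R] of_real_mult[of _ "_ ^ 4"]
      A6 Re2 ch0 weight_disc_def laplace_weight_def w_def
    by (simp add: tt of_real_cmod_square E_def E1_def E2_def)
  also have "\<dots> = of_real (h 0) * ?BB - ?A 0 * ?B 0"
    unfolding h0 ch0 a_def[symmetric] b_def[symmetric] t_def[symmetric]
    unfolding E_def[symmetric] E1_def[symmetric] w_def[symmetric]
    by (simp add: algebra_simps power2_eq_square power3_eq_cube)
  finally have "of_real (h 0) * ?BB - ?A 0 * ?B 0 = complex_of_real ?N" ..
  then have "gauss_curvature h 0 = Re (complex_of_real (- 2 / h0 ^ 3 * ?N))"
    unfolding gauss_curvature_def Let_def BB H0[OF 0] by (simp add: h0)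
  then show ?thesis by (simp only: Re_complex_of_real h0_def times_divide_eq_left)
qed

section \<open>Parabolic vector fields and the curvature of their leaves\<close>

lemma norm_square_cvec: "(norm (v::complex^'n))\<^sup>2 = (\<Sum>i\<in>UNIV. (cmod (v $ i))\<^sup>2)"
  by (simp add: norm_vec_def L2_set_def sum_nonneg)

lemma norm_square_cvec_cnj: "complex_of_real ((norm (v::complex^'n))\<^sup>2) = (\<Sum>i\<in>UNIV. v $ i * cnj (v $ i))"
  by (simp add: norm_square_cvec of_real_cmod_square)

lemma norm_add_scaled_orthogonal:
  fixes e k :: "complex^'n"
  assumes "(\<Sum>i\<in>UNIV. k $ i * cnj (e $ i)) = 0"
  shows "(norm (e + T *s k))\<^sup>2 = (norm e)\<^sup>2 + (norm k)\<^sup>2 * (cmod T)\<^sup>2"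
proof -
  have "cnj (\<Sum>i\<in>UNIV. k $ i * cnj (e $ i)) = 0" using assms by simp
  then have 2: "(\<Sum>i\<in>UNIV. e $ i * cnj (k $ i)) = 0" by (simp add: mult.commute)
  have "complex_of_real ((norm (e + T *s k))\<^sup>2) =
     (\<Sum>i\<in>UNIV. e $ i * cnj (e $ i)) + T * (\<Sum>i\<in>UNIV. k $ i * cnj (e $ i))
     + cnj T * (\<Sum>i\<in>UNIV. e $ i * cnj (k $ i)) + T * cnj T * (\<Sum>i\<in>UNIV. k $ i * cnj (k $ i))"
    unfolding norm_square_cvec_cnj by (simp add: sum.distrib sum_distrib_left algebra_simps)
  also have "\<dots> = complex_of_real ((norm e)\<^sup>2 + (norm k)\<^sup>2 * (cmod T)\<^sup>2)"
    unfolding of_real_add of_real_mult norm_square_cvec_cnj complex_norm_square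
    using assms 2 by (simp add: mult_ac)
  finally show ?thesis by (simp only: of_real_eq_iff)
qed

lemma grauert_metric_weight:
  "grauert_metric f z V = weight ((cmod (f z))\<^sup>2) * (cmod (cdiff f z V))\<^sup>2 + (norm V)\<^sup>2"
  by (simp add: grauert_metric_def weight_def)

text \<open>The functional \<open>l\<close> is a clock: \<open>l (Z T - z) = T\<close> along every integral curve \<open>Z\<close> through \<open>z\<close>, so
  the field can be integrated explicitly.\<close>

locale parabolic_field =
  fixes e k z :: "complex^'n::finite" and l :: "complex^'n \<Rightarrow> complex"
  assumes l: "bounded_linear l" "\<And>c v. l (c *s v) = c * l v" "l e = 1" "l k = 0"
begin

definition X where "X y = e + l (y - z) *s k"

text \<open>Obtained by integrating \<open>e + T *s k\<close>, the value of \<open>X\<close> at a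
  point whose clock reads \<open>T\<close>.\<close>

definition curve where "curve T = z + T *s e + (T\<^sup>2 / 2) *s k"

lemma l_add: "l (v + w) = l v + l w"
  using l(1) by (simp add: linear_simps)

lemma l_X: "l (X y) = 1"
  by (simp add: X_def l_add l)

lemma nonsingular: "nonsingular_holo_vf UNIV X"
  unfolding nonsingular_holo_vf_def
proof (intro conjI allI ballI)
  fix i
  have "((\<lambda>y. X y $ i) has_derivative (\<lambda>v. l v * k $ i)) (at y)" for y
  proof -
    have "((\<lambda>y. l (y - z)) has_derivative (\<lambda>v. l v)) (at y)"
      by (rule bounded_linear.has_derivative[OF l(1)]) (auto intro!: derivative_eq_intros)
    from has_derivative_add[OF has_derivative_const[of "e $ i"] has_derivative_mult_left[OF this, of "k $ i"]]
    show ?thesis by (simp add: X_def)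
  qed
  moreover have "\<forall>c v. l (c *s v) * k $ i = c * (l v * k $ i)" by (simp add: l)
  ultimately show "holo_on (\<lambda>y. X y $ i) UNIV"
    unfolding holo_on_def by blast
next
  fix y
  have "l 0 = 0" using l(1) by (simp add: linear_simps)
  then show "X y \<noteq> 0" using l_X[of y] by auto
qed auto

lemma curve_derivative: "(curve has_derivative (\<lambda>t. t *s (e + T *s k))) (at T)"
proof -
  have "((\<lambda>T. T\<^sup>2 / 2) has_derivative (\<lambda>t. t * T)) (at T)"
    by (auto intro!: derivative_eq_intros)
  from bounded_linear.has_derivative[OF bounded_linear_scalar_vec[of k] this]
  have "(curve has_derivative (\<lambda>t. t *s e + (t * T) *s k)) (at T)"
    unfolding curve_def[abs_def] by (intro has_derivative_add has_derivative_line)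
  then show ?thesis by (simp add: vector_add_ldistrib vector_smult_assoc)
qed

lemma X_curve: "X (curve T) = e + T *s k"
  by (simp add: X_def curve_def l_add l add.assoc)

lemma integral_curve_curve: "curve ` ball 0 \<epsilon> \<subseteq> W \<Longrightarrow> integral_curve W X \<epsilon> curve"
  unfolding integral_curve_def X_curve using curve_derivative by blast

text \<open>The clock forces \<open>l (Z S - z) = S\<close>, so the velocity of \<open>Z\<close> at
  time \<open>S\<close> is the known vector \<open>e + S *s k\<close>. Hence \<open>Z\<close> and
  \<open>curve\<close> have the same derivative on the ball and the same value at 0.\<close>

lemma integral_curve_unique:
  assumes Z: "integral_curve W X \<epsilon> Z" "Z 0 = z" and T: "T \<in> ball 0 \<epsilon>"
  shows "Z T = curve T"
proof -
  have D: "(Z has_derivative (\<lambda>t. t *s X (Z S))) (at S within ball 0 \<epsilon>)" if "S \<in> ball 0 \<epsilon>" for S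
    using Z(1) that by (auto simp: integral_curve_def has_derivative_at_withinI)
  have 0: "0 \<in> ball 0 \<epsilon>" using T by (auto intro: le_less_trans[OF norm_ge_zero])
  have l0: "l 0 = 0" using l(1) by (simp add: linear_simps)
  have lZ: "l (Z S - z) = S" if S: "S \<in> ball 0 \<epsilon>" for S
  proof -
    have "((\<lambda>S. l (Z S - z) - S) has_derivative (\<lambda>h. 0)) (at S within ball 0 \<epsilon>)" if "S \<in> ball 0 \<epsilon>" for S
    proof -
      have "((\<lambda>S. l (Z S - z)) has_derivative (\<lambda>t. l (t *s X (Z S) - 0))) (at S within ball 0 \<epsilon>)"
        by (intro bounded_linear.has_derivative[OF l(1)] has_derivative_diff has_derivative_const D that)
      from has_derivative_diff[OF this has_derivative_ident] show ?thesis
        by (simp add: l l_X)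
    qed
    from has_derivative_zero_unique[OF convex_ball this S 0] show ?thesis
      using Z(2) l0 by simp
  qed
  have "((\<lambda>S. Z S - curve S) has_derivative (\<lambda>h. 0)) (at S within ball 0 \<epsilon>)" if S: "S \<in> ball 0 \<epsilon>" for S
  proof -
    have "X (Z S) = e + S *s k" by (simp only: X_def lZ[OF S])
    with has_derivative_diff[OF D[OF S] has_derivative_at_withinI[OF curve_derivative]]
    show ?thesis by (simp only: diff_self)
  qed
  from has_derivative_zero_unique[OF convex_ball this T 0] show ?thesis
    using Z(2) by (simp add: curve_def)
qed

text \<open>Orthogonality removes the terms linear in \<open>T\<close> from
  \<open>|e + T k|^2\<close>, which brings the metric along \<open>curve\<close> into the form
  treated by \<open>gauss_curvature_pullback\<close>. Every integral curve through \<open>z\<close>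
  is \<open>curve\<close> on its disc, so the description in \<open>leaf_curvature\<close> has a
  unique solution.\<close>

lemma leaf_curvature_eq:
  assumes f: "holo_on f UNIV" "f z \<noteq> 0"
    and orth: "(\<Sum>i\<in>UNIV. k $ i * cnj (e $ i)) = 0"
  defines "a \<equiv> cdiff f z e" and "b \<equiv> (deriv ^^ 2) (\<lambda>T. f (curve T)) 0" and "t \<equiv> (cmod (f z))\<^sup>2"
    and "R \<equiv> (norm e)\<^sup>2" and "Q \<equiv> (norm k)\<^sup>2"
  shows "leaf_curvature (grauert_metric f) (UNIV - {z. f z = 0}) X z =
    - 2 * ((cmod a) ^ 6 * weight_disc t
        + R * (laplace_weight t * (cmod a) ^ 4 + 2 * deriv weight t * Re (cnj (f z) * a\<^sup>2 * cnj b)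
               + weight t * (cmod b)\<^sup>2)
        + (weight t * (cmod a)\<^sup>2 + R) * Q) / (weight t * (cmod a)\<^sup>2 + R) ^ 3" (is "_ = ?\<kappa>")
proof -
  let ?F = "\<lambda>T. f (curve T)" and ?W = "UNIV - {z. f z = 0}"
  have DF: "(?F has_field_derivative cdiff f (curve T) (e + T *s k)) (at T)" for T
    by (rule holo_on_chain[OF f(1) UNIV_I curve_derivative])
  then have dF: "deriv ?F T = cdiff f (curve T) (e + T *s k)" for T
    by (rule DERIV_imp_deriv)
  have hol: "?F holomorphic_on S" for S
    by (rule holomorphic_onI) (metis DF field_differentiable_at_within field_differentiable_def)
  have c0: "curve 0 = z" by (simp add: curve_def)
  have R: "R > 0" using l(3) l(1) by (auto simp: R_def linear_simps)
  have val: "gauss_curvature (\<lambda>T. grauert_metric f (Z T) (X (Z T))) 0 = ?\<kappa>"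
    if "\<epsilon> > 0" "integral_curve ?W X \<epsilon> Z" "Z 0 = z" for \<epsilon> Z
  proof -
    have Z: "Z T = curve T" if "T \<in> ball 0 \<epsilon>" for T
      using integral_curve_unique[OF \<open>integral_curve ?W X \<epsilon> Z\<close> \<open>Z 0 = z\<close> that] .
    have nz: "?F T \<noteq> 0" if "T \<in> ball 0 \<epsilon>" for T
      using \<open>integral_curve ?W X \<epsilon> Z\<close> Z[OF that] that by (force simp: integral_curve_def)
    have h: "grauert_metric f (Z T) (X (Z T)) =
        weight ((cmod (?F T))\<^sup>2) * (cmod (deriv ?F T))\<^sup>2 + R + Q * (cmod T)\<^sup>2" if "T \<in> ball 0 \<epsilon>" for T
      by (simp add: grauert_metric_weight Z[OF that] X_curve dF norm_add_scaled_orthogonal[OF orth] R_def Q_def)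
    show ?thesis
      using gauss_curvature_pullback[OF hol \<open>\<epsilon> > 0\<close> nz h R]
      by (simp add: dF[of 0] c0 a_def b_def t_def numeral_2_eq_2)
  qed
  \<comment> \<open>Existence: \<open>curve\<close> begins outside the zero set of \<open>f\<close>
    and remains outside it on a small disc.\<close>
  have "open {T. ?F T \<noteq> 0}"
    by (intro open_Collect_neq holomorphic_on_imp_continuous_on hol continuous_on_const)
  moreover have "0 \<in> {T. ?F T \<noteq> 0}" using f(2) c0 by simp
  ultimately obtain \<epsilon> where \<epsilon>: "\<epsilon> > 0" "ball 0 \<epsilon> \<subseteq> {T. ?F T \<noteq> 0}"
    by (meson open_contains_ball)
  then have ic: "integral_curve ?W X \<epsilon> curve" by (intro integral_curve_curve) auto
  show ?thesis
    unfolding leaf_curvature_def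
  proof (rule the_equality)
    show "\<exists>\<epsilon>>0. \<exists>Z. integral_curve ?W X \<epsilon> Z \<and> Z 0 = z \<and>
        ?\<kappa> = gauss_curvature (\<lambda>T. grauert_metric f (Z T) (X (Z T))) 0"
      by (intro exI[of _ \<epsilon>] exI[of _ curve] conjI \<epsilon>(1) ic c0 val[OF \<epsilon>(1) ic c0, symmetric])
    show "\<kappa> = ?\<kappa>" if H: "\<exists>\<epsilon>>0. \<exists>Z. integral_curve ?W X \<epsilon> Z \<and> Z 0 = z \<and>
        \<kappa> = gauss_curvature (\<lambda>T. grauert_metric f (Z T) (X (Z T))) 0" for \<kappa>
    proof -
      from H obtain \<epsilon> Z where "\<epsilon> > 0" "integral_curve ?W X \<epsilon> Z" "Z 0 = z"
        and \<kappa>: "\<kappa> = gauss_curvature (\<lambda>T. grauert_metric f (Z T) (X (Z T))) 0"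
        by (elim exE conjE)
      from val[OF this(1-3)] \<kappa> show ?thesis by (simp only:)
    qed
  qed
qed

text \<open>Completing the square eliminates the second derivative \<open>b\<close>, which depends on \<open>k\<close>; what remains
  is dominated by a large transversal component \<open>k\<close>.\<close>

lemma leaf_curvature_nonpos:
  assumes f: "holo_on f UNIV" "f z \<noteq> 0"
    and orth: "(\<Sum>i\<in>UNIV. k $ i * cnj (e $ i)) = 0"
    and Q: "(cmod (cdiff f z e)) ^ 4 * \<bar>weight_disc ((cmod (f z))\<^sup>2)\<bar> \<le> (norm k)\<^sup>2"
  shows "leaf_curvature (grauert_metric f) (UNIV - {z. f z = 0}) X z \<le> 0"
proof -
  define a b t R Q where "a = cdiff f z e" and "b = (deriv ^^ 2) (\<lambda>T. f (curve T)) 0"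
    and "t = (cmod (f z))\<^sup>2" and "R = (norm e)\<^sup>2" and "Q = (norm k)\<^sup>2"
  define E E1 where "E = weight t" and "E1 = deriv weight t"
  define m where "m = laplace_weight t * (cmod a) ^ 4 + 2 * E1 * Re (cnj (f z) * a\<^sup>2 * cnj b) + E * (cmod b)\<^sup>2"
  define h where "h = E * (cmod a)\<^sup>2 + R"
  have E: "E \<ge> 1" by (simp add: E_def t_def weight_ge_1)
  have "R \<ge> 0" by (simp add: R_def)
  then have h: "h \<ge> 0" using E by (simp add: h_def)
  have sq: "(cmod (x + y))\<^sup>2 = (cmod x)\<^sup>2 + (cmod y)\<^sup>2 + 2 * Re (x * cnj y)" for x y
    unfolding cmod_power2 by (simp add: power2_eq_square algebra_simps)
  have "0 \<le> (cmod (of_real E1 * (cnj (f z) * a\<^sup>2) + of_real E * b))\<^sup>2" by simp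
  also have "\<dots> = E1\<^sup>2 * t * (cmod a) ^ 4 + E\<^sup>2 * (cmod b)\<^sup>2 + 2 * (E1 * E * Re (cnj (f z) * a\<^sup>2 * cnj b))"
  proof -
    have "Re (of_real E1 * (cnj (f z) * a\<^sup>2) * cnj (of_real E * b)) = Re (of_real (E1 * E) * (cnj (f z) * a\<^sup>2 * cnj b))"
      by (simp add: mult_ac)
    also have "\<dots> = E1 * E * Re (cnj (f z) * a\<^sup>2 * cnj b)"
    proof -
      have "Re (of_real x * y) = x * Re y" for x y by simp
      then show ?thesis .
    qed
    finally show ?thesis
      unfolding sq by (simp add: norm_mult norm_power power_mult_distrib t_def)
  qed
  also have "\<dots> = E * m - weight_disc t * (cmod a) ^ 4"
    by (simp add: m_def weight_disc_def E_def E1_def algebra_simps power2_eq_square)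
  finally have m: "weight_disc t * (cmod a) ^ 4 \<le> E * m" by simp
  have "- ((cmod a) ^ 4 * weight_disc t) \<le> (cmod a) ^ 4 * \<bar>weight_disc t\<bar>"
    by (metis abs_ge_minus_self abs_mult abs_of_nonneg norm_ge_zero zero_le_power)
  also have "\<dots> \<le> Q" using Q unfolding a_def t_def Q_def .
  also have "\<dots> \<le> E * Q" using mult_right_mono[OF E, of Q] by (simp add: Q_def)
  \<comment> \<open>As \<open>h = E * (cmod a)^2 + R\<close>, this product contains \<open>E\<close>
    times the \<open>(cmod a)^6\<close> term and a term in \<open>R\<close> bounded by
    \<open>R * (E * m)\<close>. The bound is then \<open>E\<close> times the numerator
    sought.\<close>
  finally have "0 \<le> h * ((cmod a) ^ 4 * weight_disc t + E * Q)" using h by simp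
  also have "\<dots> = E * (cmod a) ^ 6 * weight_disc t + R * (weight_disc t * (cmod a) ^ 4) + E * (h * Q)"
    by (simp add: h_def algebra_simps power2_eq_square eval_nat_numeral)
  also have "\<dots> \<le> E * (cmod a) ^ 6 * weight_disc t + R * (E * m) + E * (h * Q)"
    using m \<open>R \<ge> 0\<close> by (simp add: mult_left_mono)
  also have "\<dots> = E * ((cmod a) ^ 6 * weight_disc t + R * m + h * Q)"
    by (simp add: algebra_simps)
  finally have N: "0 \<le> (cmod a) ^ 6 * weight_disc t + R * m + h * Q"
    using E by (simp add: zero_le_mult_iff)
  have "leaf_curvature (grauert_metric f) (UNIV - {z. f z = 0}) X z
      = - 2 * ((cmod a) ^ 6 * weight_disc t + R * m + h * Q) / h ^ 3"
    unfolding leaf_curvature_eq[OF f orth] m_def h_def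
      a_def b_def t_def R_def Q_def E_def E1_def ..
  also have "\<dots> \<le> 0" using N h by (intro divide_nonpos_nonneg) auto
  finally show ?thesis .
qed

end

section \<open>Derivatives along lines\<close>

text \<open>Provides a single ball containing all the discs on which Cauchy estimates are taken, so
  that the bounds are uniform in \<open>z\<close>.\<close>

lemma cball_line_bounded:
  fixes p v :: "complex^'n"
  obtains M where "\<And>z T. z \<in> cball p r \<Longrightarrow> cmod T \<le> s \<Longrightarrow> z + T *s v \<in> cball p M"
proof -
  obtain K where K: "K > 0" "\<And>T. norm (T *s v) \<le> norm T * K"
    using bounded_linear.pos_bounded[OF bounded_linear_scalar_vec[of v]] by blast
  have "z + T *s v \<in> cball p (r + s * K)" if "z \<in> cball p r" "cmod T \<le> s" for z T
  proof -
    have "norm (T *s v) \<le> s * K"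
      using K(2)[of T] \<open>cmod T \<le> s\<close> K(1) by (meson mult_right_mono less_imp_le order_trans)
    then show ?thesis
      using \<open>z \<in> cball p r\<close> norm_triangle_ineq[of "z - p" "T *s v"]
      by (simp add: dist_norm norm_minus_commute algebra_simps)
  qed
  then show ?thesis by (rule that)
qed

text \<open>Uniform continuity on a compact ball makes the restrictions of \<open>f\<close> to
  nearby parallel discs uniformly close, and Cauchy's inequality transfers this to their
  derivatives.\<close>

lemma higher_deriv_line_continuous:
  fixes p :: "complex^'n"
  assumes f: "holo_on f UNIV"
  shows "isCont (\<lambda>z. (deriv ^^ m) (\<lambda>T. f (z + T *s v)) 0) p"
  unfolding continuous_at_eps_delta
proof (intro allI impI)
  fix e :: real assume e: "e > 0"
  \<comment> \<open>Cauchy's inequality on the unit circle costs a factor \<open>fact m\<close>; the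
    factor 2 makes the final estimate strict.\<close>
  define e' where "e' = e / (2 * fact m)"
  have e': "e' > 0" using e by (simp add: e'_def)
  obtain M where M: "\<And>z T. z \<in> cball p 1 \<Longrightarrow> cmod T \<le> 1 \<Longrightarrow> z + T *s v \<in> cball p M"
    using cball_line_bounded[of p 1 1 v] by blast
  have "uniformly_continuous_on (cball p M) f"
    by (intro compact_uniformly_continuous continuous_on_subset[OF holo_on_continuous[OF f]]) auto
  then obtain d where d: "d > 0" "\<And>x x'. x \<in> cball p M \<Longrightarrow> x' \<in> cball p M \<Longrightarrow> dist x' x < d \<Longrightarrow> dist (f x') (f x) < e'"
    using e' by (rule uniformly_continuous_onE) blast
  have "dist ((deriv ^^ m) (\<lambda>T. f (z + T *s v)) 0) ((deriv ^^ m) (\<lambda>T. f (p + T *s v)) 0) < e"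
    if z: "dist z p < min d 1" for z
  proof -
    let ?g = "\<lambda>T. f (z + T *s v) - f (p + T *s v)"
    have hol: "?g holomorphic_on UNIV" by (intro holomorphic_on_diff entire_line f)
    have "cmod ((deriv ^^ m) ?g 0) \<le> fact m * e' / 1 ^ m"
    proof (rule Cauchy_inequality)
      show "?g holomorphic_on ball 0 1" using hol by (rule holomorphic_on_subset) auto
      show "continuous_on (cball 0 1) ?g"
        by (intro holomorphic_on_imp_continuous_on holomorphic_on_subset[OF hol]) auto
      fix T assume "cmod (0 - T) = 1"
      then have T: "cmod T \<le> 1" by simp
      have "z \<in> cball p 1" "p \<in> cball p 1" using z by (auto simp: dist_commute)
      then have "z + T *s v \<in> cball p M" "p + T *s v \<in> cball p M" using M T by blast+
      from d(2)[OF this(2,1)] show "cmod (?g T) \<le> e'" using z by (simp add: dist_norm)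
    qed simp
    also have "\<dots> < e" using e by (simp add: e'_def)
    also have "(deriv ^^ m) ?g 0 = (deriv ^^ m) (\<lambda>T. f (z + T *s v)) 0 - (deriv ^^ m) (\<lambda>T. f (p + T *s v)) 0"
      by (rule higher_deriv_diff[of _ UNIV]) (auto intro: entire_line f)
    finally show ?thesis by (simp add: dist_norm)
  qed
  then show "\<exists>d>0. \<forall>z. dist z p < d \<longrightarrow>
      dist ((deriv ^^ m) (\<lambda>T. f (z + T *s v)) 0) ((deriv ^^ m) (\<lambda>T. f (p + T *s v)) 0) < e"
    using d(1) by (intro exI[of _ "min d 1"]) auto
qed

text \<open>A weak form of holomorphy that is easily seen to be inherited by partial derivatives.\<close>

definition line_entire :: "(complex^'n \<Rightarrow> complex) \<Rightarrow> bool" where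
  "line_entire f \<longleftrightarrow> (\<forall>z v. (\<lambda>t. f (z + t *s v)) holomorphic_on UNIV) \<and> (\<forall>p r. bounded (f ` cball p r))"

lemma holo_on_imp_line_entire: "holo_on f UNIV \<Longrightarrow> line_entire f"
  unfolding line_entire_def
  by (auto intro!: entire_line compact_imp_bounded compact_continuous_image
      intro: continuous_on_subset[OF holo_on_continuous])

lemma line_entire_bound:
  assumes "line_entire f"
  obtains B where "\<And>y. y \<in> cball p r \<Longrightarrow> cmod (f y) \<le> B"
  using assms unfolding line_entire_def bounded_iff by (metis imageI)

lemma line_entire_DERIV:
  assumes "line_entire f"
  shows "((\<lambda>t. f (z + t *s axis i 1)) has_field_derivative pderiv_z i f z) (at 0)"
  using assms holomorphic_derivI[of "\<lambda>t. f (z + t *s axis i 1)" UNIV 0]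
  by (auto simp: line_entire_def pderiv_z_def)

lemma line_entire_pderiv_bounded:
  fixes p :: "complex^'n"
  assumes f: "line_entire f"
  shows "bounded (pderiv_z i f ` cball p r)"
proof -
  obtain M where M: "\<And>y T. y \<in> cball p r \<Longrightarrow> cmod T \<le> 1 \<Longrightarrow> y + T *s axis i 1 \<in> cball p M"
    using cball_line_bounded[of p r 1 "axis i 1"] by blast
  obtain B where B: "\<And>y. y \<in> cball p M \<Longrightarrow> cmod (f y) \<le> B"
    using line_entire_bound[OF f] by blast
  have "cmod (pderiv_z i f y) \<le> B" if y: "y \<in> cball p r" for y
  proof -
    have g: "(\<lambda>T. f (y + T *s axis i 1)) holomorphic_on S" for S
      using f by (auto simp: line_entire_def intro: holomorphic_on_subset)
    have "cmod ((deriv ^^ 1) (\<lambda>T. f (y + T *s axis i 1)) 0) \<le> fact 1 * B / 1 ^ 1"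
      by (rule Cauchy_inequality[OF g holomorphic_on_imp_continuous_on[OF g]]) (auto intro!: B M y)
    then show ?thesis by (simp add: pderiv_z_def)
  qed
  then show ?thesis by (auto simp: bounded_iff intro!: exI[of _ B])
qed

text \<open>The difference quotients in direction \<open>axis i 1\<close> are holomorphic in \<open>t\<close> and converge locally
  uniformly.\<close>

lemma line_entire_pderiv_holomorphic:
  fixes z :: "complex^'n"
  assumes f: "line_entire f"
  shows "(\<lambda>t. pderiv_z i f (z + t *s w)) holomorphic_on UNIV"
proof (rule holomorphic_uniform_sequence)
  let ?q = "\<lambda>n t. (f ((z + inverse (of_nat (Suc n)) *s axis i 1) + t *s w) - f (z + t *s w)) * of_nat (Suc n)"
  show "?q n holomorphic_on UNIV" for n
    using f by (intro holomorphic_intros) (auto simp: line_entire_def)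
  fix t0 :: complex
  define r where "r = cmod t0 + 1"
  obtain M where M: "\<And>y T. y \<in> cball z 0 \<Longrightarrow> cmod T \<le> r \<Longrightarrow> y + T *s w \<in> cball z M"
    using cball_line_bounded[of z 0 r w] by blast
  \<comment> \<open>Radius 2 accommodates unit Cauchy circles about every point of the unit
    disc.\<close>
  obtain M' where M': "\<And>y T. y \<in> cball z M \<Longrightarrow> cmod T \<le> 2 \<Longrightarrow> y + T *s axis i 1 \<in> cball z M'"
    using cball_line_bounded[of z M 2 "axis i 1"] by blast
  obtain B where B: "\<And>y. y \<in> cball z M' \<Longrightarrow> cmod (f y) \<le> B"
    using line_entire_bound[OF f] by blast
  \<comment> \<open>Second order Taylor remainder: Cauchy bounds the second derivative by
    \<open>2 * B\<close>, and division by the step, at most 1 in modulus thanks to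
    \<open>Suc n\<close>, leaves one power of it.\<close>
  have est: "cmod (?q n t - pderiv_z i f (z + t *s w)) \<le> 2 * B / of_nat (Suc n)" if "t \<in> cball t0 1" for n t
  proof -
    let ?y = "z + t *s w" and ?h = "inverse (of_nat (Suc n)) :: complex"
    let ?g = "\<lambda>s. f (?y + s *s axis i 1)"
    have "cmod t \<le> r" using that norm_triangle_sub[of t t0] by (simp add: r_def dist_norm norm_minus_commute)
    then have y: "?y \<in> cball z M" by (intro M) auto
    have g: "?g holomorphic_on S" for S
      using f by (auto simp: line_entire_def intro: holomorphic_on_subset)
    have "cmod ((deriv ^^ 0) ?g ?h - (\<Sum>j\<le>1. (deriv ^^ j) ?g 0 * (?h - 0) ^ j / fact j))
      \<le> (2 * B) * cmod (?h - 0) ^ Suc 1 / fact 1"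
    proof (rule complex_Taylor[of "cball 0 1"])
      show "((deriv ^^ j) ?g has_field_derivative (deriv ^^ Suc j) ?g s) (at s within cball 0 1)" for j s
        using holomorphic_derivI[OF holomorphic_higher_deriv[OF g[of UNIV] open_UNIV] open_UNIV UNIV_I]
          has_field_derivative_at_within by simp
      show "?h \<in> cball 0 1"
        by (simp add: norm_inverse inverse_le_1_iff del: of_nat_Suc)
      fix s :: complex assume s: "s \<in> cball 0 1"
      have "cmod ((deriv ^^ 2) ?g s) \<le> fact 2 * B / 1 ^ 2"
      proof (rule Cauchy_inequality[OF g holomorphic_on_imp_continuous_on[OF g]])
        fix x assume "cmod (s - x) = 1"
        then have "cmod x \<le> 2" using s norm_triangle_sub[of x s] by (simp add: norm_minus_commute)
        then show "cmod (?g x) \<le> B" by (intro B M' y)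
      qed simp
      then show "cmod ((deriv ^^ Suc 1) ?g s) \<le> 2 * B" by (simp add: numeral_2_eq_2)
    qed auto
    moreover have "deriv ?g 0 = pderiv_z i f ?y" by (simp add: pderiv_z_def)
    ultimately have "cmod (?g ?h - (?g 0 + pderiv_z i f ?y * ?h)) \<le> 2 * B * (cmod ?h)\<^sup>2"
      by (simp add: power2_eq_square)
    then have "cmod (of_nat (Suc n)) * cmod (?g ?h - (?g 0 + pderiv_z i f ?y * ?h))
        \<le> cmod (of_nat (Suc n)) * (2 * B * (cmod ?h)\<^sup>2)"
      by (rule mult_left_mono) simp
    also have "\<dots> = 2 * B / of_nat (Suc n)"
    proof -
      have h: "cmod ?h = 1 / of_nat (Suc n)"
        by (simp add: norm_inverse divide_inverse del: of_nat_Suc)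
      show ?thesis
        unfolding norm_of_nat h by (simp add: power2_eq_square field_simps del: of_nat_Suc)
    qed
    also have "cmod (of_nat (Suc n)) * cmod (?g ?h - (?g 0 + pderiv_z i f ?y * ?h)) = cmod (?q n t - pderiv_z i f ?y)"
    proof -
      have "of_nat (Suc n) * (?g ?h - (?g 0 + pderiv_z i f ?y * ?h)) = ?q n t - pderiv_z i f ?y"
        by (simp add: field_simps add_ac del: of_nat_Suc)
      then show ?thesis by (metis norm_mult)
    qed
    finally show ?thesis .
  qed
  have "uniform_limit (cball t0 1) ?q (\<lambda>t. pderiv_z i f (z + t *s w)) sequentially"
    unfolding uniform_limit_iff
  proof (intro allI impI)
    fix e :: real assume "e > 0"
    have "(\<lambda>n. 2 * B / of_nat (Suc n)) \<longlonglongrightarrow> 0"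
      by (rule LIMSEQ_Suc[OF lim_const_over_n])
    then have "\<forall>\<^sub>F n in sequentially. 2 * B / of_nat (Suc n) < e"
      using \<open>e > 0\<close> by (rule order_tendstoD)
    then show "\<forall>\<^sub>F n in sequentially. \<forall>t\<in>cball t0 1. dist (?q n t) (pderiv_z i f (z + t *s w)) < e"
      by eventually_elim (unfold dist_norm, blast intro: le_less_trans[OF est])
  qed
  then show "\<exists>d>0. cball t0 d \<subseteq> UNIV \<and> uniform_limit (cball t0 d) ?q (\<lambda>t. pderiv_z i f (z + t *s w)) sequentially"
    by (intro exI[of _ 1]) auto
qed simp

lemma line_entire_pderiv: "line_entire f \<Longrightarrow> line_entire (pderiv_z i f)"
  using line_entire_pderiv_holomorphic line_entire_pderiv_bounded
  unfolding line_entire_def[of "pderiv_z i f"] by blast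

section \<open>Curvature in the kernel of the differential\<close>

definition grad_square :: "(complex^'n \<Rightarrow> complex) \<Rightarrow> complex^'n \<Rightarrow> real" where
  "grad_square f z = (\<Sum>i\<in>UNIV. (cmod (pderiv_z i f z))\<^sup>2)"

lemma grad_square_nonneg: "grad_square f z \<ge> 0"
  by (simp add: grad_square_def sum_nonneg)

lemma of_real_grad_square:
  "complex_of_real (grad_square f z) = (\<Sum>i\<in>UNIV. pderiv_z i f z * cnj (pderiv_z i f z))"
  by (simp add: grad_square_def of_real_cmod_square)

lemma of_real_grauert_metric:
  "complex_of_real (grauert_metric f z V) = of_real (weight ((cmod (f z))\<^sup>2)) * (cdiff f z V * cnj (cdiff f z V))
     + (\<Sum>m\<in>UNIV. V $ m * cnj (V $ m))"
  unfolding grauert_metric_weight of_real_add norm_square_cvec_cnj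
  by (simp add: of_real_cmod_square)

lemma cdiff_diff: "cdiff F z (v - w) = cdiff F z v - cdiff F z w"
  by (simp add: cdiff_def sum_subtractf algebra_simps)

text \<open>Polarisation is applied separately to the rank one part and to the Euclidean part of the
  metric.\<close>

lemma metric_coeff_grauert:
  "metric_coeff (grauert_metric f) i j z =
     of_real (weight ((cmod (f z))\<^sup>2)) * (pderiv_z i f z * cnj (pderiv_z j f z)) + (if i = j then 1 else 0)"
proof -
  define E where "E = complex_of_real (weight ((cmod (f z))\<^sup>2))"
  have herm: "herm_form (grauert_metric f) z V W = E * (cdiff f z V * cnj (cdiff f z W)) + (\<Sum>m\<in>UNIV. V $ m * cnj (W $ m))"
    for V W
  proof -
    have 1: "(\<Sum>m\<in>UNIV. (V + W) $ m * cnj ((V + W) $ m)) - (\<Sum>m\<in>UNIV. (V - W) $ m * cnj ((V - W) $ m))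
      + \<i> * (\<Sum>m\<in>UNIV. (V + \<i> *s W) $ m * cnj ((V + \<i> *s W) $ m))
      - \<i> * (\<Sum>m\<in>UNIV. (V - \<i> *s W) $ m * cnj ((V - \<i> *s W) $ m)) = (\<Sum>m\<in>UNIV. 4 * (V $ m * cnj (W $ m)))"
      unfolding sum_distrib_left sum.distrib[symmetric] sum_subtractf[symmetric]
      by (rule sum.cong) (auto simp: algebra_simps)
    have 2: "(v + w) * cnj (v + w) - (v - w) * cnj (v - w) + \<i> * ((v + \<i> * w) * cnj (v + \<i> * w))
       - \<i> * ((v - \<i> * w) * cnj (v - \<i> * w)) = 4 * (v * cnj w)" for v w
      by (simp add: algebra_simps)
    have 3: "(E * p1 + q1) - (E * p2 + q2) + \<i> * (E * p3 + q3) - \<i> * (E * p4 + q4)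
      = E * (p1 - p2 + \<i> * p3 - \<i> * p4) + (q1 - q2 + \<i> * q3 - \<i> * q4)" for p1 p2 p3 p4 q1 q2 q3 q4
      by (simp add: algebra_simps)
    have "4 * herm_form (grauert_metric f) z V W = E * (4 * (cdiff f z V * cnj (cdiff f z W)))
        + (\<Sum>m\<in>UNIV. 4 * (V $ m * cnj (W $ m)))"
      unfolding herm_form_def of_real_grauert_metric cdiff_add cdiff_diff cdiff_scale E_def[symmetric] 3 1 2
      by simp
    also have "\<dots> = 4 * (E * (cdiff f z V * cnj (cdiff f z W)) + (\<Sum>m\<in>UNIV. V $ m * cnj (W $ m)))"
      by (simp add: sum_distrib_left distrib_left)
    finally show ?thesis by (simp only: mult_cancel_left) simp
  qed
  have "(\<Sum>m\<in>UNIV. axis i 1 $ m * cnj (axis j 1 $ m)) = (\<Sum>m\<in>UNIV. if m = i then (if i = j then 1 else 0) else 0 :: complex)"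
    by (rule sum.cong) (auto simp: axis_def)
  then show ?thesis
    by (simp add: metric_coeff_def herm cdiff_axis E_def)
qed

lemma matrix_inv_eqI:
  fixes A B :: "'a::semiring_1^'n^'n"
  assumes "A ** B = mat 1" "B ** A = mat 1"
  shows "matrix_inv A = B"
  unfolding matrix_inv_def
  by (rule some_equality) (use assms in \<open>auto, metis matrix_mul_assoc matrix_mul_lid matrix_mul_rid\<close>)

text \<open>This is the Sherman-Morrison formula for a rank one perturbation of the
  identity.\<close>

lemma metric_inv_coeff_grauert:
  fixes f :: "complex^'n::finite \<Rightarrow> complex"
  defines "E \<equiv> \<lambda>z. weight ((cmod (f z))\<^sup>2)"
  shows "metric_inv_coeff (grauert_metric f) a b z = (if a = b then 1 else 0)
    - of_real (E z / (1 + E z * grad_square f z)) * (pderiv_z b f z * cnj (pderiv_z a f z))"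
proof -
  define e where "e = complex_of_real (E z)"
  define N where "N = complex_of_real (grad_square f z)"
  define c where "c = e / (1 + e * N)"
  let ?f = "\<lambda>i. pderiv_z i f z"
  have "E z \<ge> 1" by (simp add: E_def weight_ge_1)
  then have "1 + E z * grad_square f z \<noteq> 0"
    using mult_nonneg_nonneg[OF _ grad_square_nonneg[of f z], of "E z"] by linarith
  then have "complex_of_real (1 + E z * grad_square f z) \<noteq> 0" by (simp only: of_real_eq_0_iff simp_thms)
  then have "1 + e * N \<noteq> 0" by (simp add: e_def N_def)
  then have "c * (1 + e * N) = e" by (simp add: c_def)
  then have c: "c + e * c * N = e" by (simp add: algebra_simps)
  have N: "(\<Sum>m\<in>UNIV. ?f m * cnj (?f m)) = N"
    by (simp add: N_def of_real_grad_square)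
  let ?A = "(\<chi> i j. metric_coeff (grauert_metric f) i j z) :: complex^'n^'n"
  let ?M = "(\<chi> i j. (if i = j then 1 else 0) - c * (?f i * cnj (?f j))) :: complex^'n^'n"
  \<comment> \<open>The product of two perturbations of the identity by multiples \<open>x\<close>
    and \<open>y\<close> of the same rank one matrix; it is the identity when
    \<open>x * y * N + x + y = 0\<close>, which is the equation \<open>c\<close> solves.\<close>
  have key: "(\<Sum>k\<in>UNIV. (x * (?f i * cnj (?f k)) + (if i = k then 1 else 0)) * (y * (?f k * cnj (?f j)) + (if k = j then 1 else 0)))
      = (x * y * N + x + y) * (?f i * cnj (?f j)) + (if i = j then 1 else 0)" for x y i j
  proof -
    have "(\<Sum>k\<in>UNIV. (x * (?f i * cnj (?f k)) + (if i = k then 1 else 0)) * (y * (?f k * cnj (?f j)) + (if k = j then 1 else 0)))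
      = (\<Sum>k\<in>UNIV. x * y * (?f i * cnj (?f j)) * (?f k * cnj (?f k)) + (if k = i then y * (?f i * cnj (?f j)) else 0)
          + (if k = j then x * (?f i * cnj (?f j)) else 0) + (if k = i then (if i = j then 1 else 0) else 0))"
      by (rule sum.cong) (auto simp: algebra_simps)
    also have "\<dots> = (x * y * N + x + y) * (?f i * cnj (?f j)) + (if i = j then 1 else 0)"
      by (simp add: sum.distrib flip: sum_distrib_left N) (simp add: algebra_simps)
    finally show ?thesis .
  qed
  have M: "?M = (\<chi> i j. - c * (?f i * cnj (?f j)) + (if i = j then 1 else 0))"
    by (simp add: vec_eq_iff)
  have e: "complex_of_real (weight ((cmod (f z))\<^sup>2)) = e" by (simp add: e_def E_def)
  have z0: "e * - c * N + e + - c = 0" "- c * e * N + - c + e = 0"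
    using c by (simp_all add: algebra_simps)
  have "?A ** ?M = mat 1" "?M ** ?A = mat 1"
    unfolding M metric_coeff_grauert e
    by (simp_all only: matrix_matrix_mult_def vec_eq_iff vec_lambda_beta key z0 mat_def) simp_all
  then have "matrix_inv ?A = ?M"
    by (rule matrix_inv_eqI)
  then show ?thesis
    by (simp add: metric_inv_coeff_def c_def e_def N_def)
qed

lemma metric_coeff_grauert_wirtinger:
  fixes f :: "complex^'n::finite \<Rightarrow> complex"
  assumes f: "line_entire f" "f z \<noteq> 0"
  defines "t \<equiv> (cmod (f z))\<^sup>2"
  shows "pd_z k (metric_coeff (grauert_metric f) i j) z =
      of_real (deriv weight t) * (pderiv_z k f z * cnj (f z)) * (pderiv_z i f z * cnj (pderiv_z j f z))
      + of_real (weight t) * (pderiv_z k (pderiv_z i f) z * cnj (pderiv_z j f z))" (is "_ = ?A")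
    and "pd_zbar k (metric_coeff (grauert_metric f) i j) z =
      of_real (deriv weight t) * (f z * cnj (pderiv_z k f z)) * (pderiv_z i f z * cnj (pderiv_z j f z))
      + of_real (weight t) * (pderiv_z i f z * cnj (pderiv_z k (pderiv_z j f) z))" (is "_ = ?B")
proof -
  note D = line_entire_DERIV[OF f(1), of z k] line_entire_DERIV[OF line_entire_pderiv[OF f(1)], of _ z k]
  note W = has_wirtinger_DERIV has_wirtinger_cnj[OF has_wirtinger_DERIV] has_wirtinger_const
    has_wirtinger_add has_wirtinger_mult
  have pos: "(cmod (f (z + 0 *s axis k 1)))\<^sup>2 > 0" using f(2) by simp
  have "has_wirtinger (\<lambda>s. metric_coeff (grauert_metric f) i j (z + s *s axis k 1)) ?A ?B 0"
    unfolding metric_coeff_grauert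
    by (rule has_wirtinger_eq, (rule W D has_wirtinger_norm_compose weight_DERIV pos)+)
       (simp_all add: t_def algebra_simps)
  from has_wirtinger_imp[OF this]
  show "pd_z k (metric_coeff (grauert_metric f) i j) z = ?A"
    and "pd_zbar k (metric_coeff (grauert_metric f) i j) z = ?B"
    unfolding pd_z_def pd_zbar_def .
qed

lemma metric_coeff_grauert_wirtinger2:
  fixes f :: "complex^'n::finite \<Rightarrow> complex"
  assumes f: "line_entire f" "f z \<noteq> 0"
  defines "t \<equiv> (cmod (f z))\<^sup>2"
  defines "E \<equiv> complex_of_real (weight t)" and "E1 \<equiv> complex_of_real (deriv weight t)"
    and "E2 \<equiv> complex_of_real (deriv (deriv weight) t)"
  shows "pd_z k (pd_zbar l (metric_coeff (grauert_metric f) i j)) z =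
      E2 * (pderiv_z k f z * cnj (f z)) * (f z * cnj (pderiv_z l f z)) * (pderiv_z i f z * cnj (pderiv_z j f z))
      + E1 * (pderiv_z k f z * cnj (pderiv_z l f z)) * (pderiv_z i f z * cnj (pderiv_z j f z))
      + E1 * (f z * cnj (pderiv_z l f z)) * (pderiv_z k (pderiv_z i f) z * cnj (pderiv_z j f z))
      + E1 * (pderiv_z k f z * cnj (f z)) * (pderiv_z i f z * cnj (pderiv_z l (pderiv_z j f) z))
      + E * (pderiv_z k (pderiv_z i f) z * cnj (pderiv_z l (pderiv_z j f) z))" (is "_ = ?A")
proof -
  note D = line_entire_DERIV[OF f(1), of z k] line_entire_DERIV[OF line_entire_pderiv[OF f(1)], of _ z k]
    line_entire_DERIV[OF line_entire_pderiv[OF line_entire_pderiv[OF f(1)]], of _ _ z k]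
  note W = has_wirtinger_DERIV has_wirtinger_cnj[OF has_wirtinger_DERIV] has_wirtinger_const
    has_wirtinger_add has_wirtinger_mult
  have pos: "(cmod (f (z + 0 *s axis k 1)))\<^sup>2 > 0" using f(2) by simp
  let ?B = "\<lambda>z. of_real (deriv weight ((cmod (f z))\<^sup>2)) * (f z * cnj (pderiv_z l f z)) * (pderiv_z i f z * cnj (pderiv_z j f z))
      + of_real (weight ((cmod (f z))\<^sup>2)) * (pderiv_z i f z * cnj (pderiv_z l (pderiv_z j f) z))"
  let ?S = "{s. f (z + s *s axis k 1) \<noteq> 0}"
  have "\<exists>c. has_wirtinger (\<lambda>s. ?B (z + s *s axis k 1)) ?A c 0"
    by (rule exI, rule has_wirtinger_eq, (rule W D has_wirtinger_norm_compose weight_DERIV pos)+)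
       (simp_all add: t_def E_def E1_def E2_def algebra_simps)
  then obtain c where c: "has_wirtinger (\<lambda>s. ?B (z + s *s axis k 1)) ?A c 0" ..
  \<comment> \<open>The first derivative formula is valid on this open part of the coordinate line,
    so it can be differentiated at 0.\<close>
  have "open ?S"
    using f(1) by (intro open_Collect_neq holomorphic_on_imp_continuous_on continuous_on_const)
      (auto simp: line_entire_def)
  with c have "has_wirtinger (\<lambda>s. pd_zbar l (metric_coeff (grauert_metric f) i j) (z + s *s axis k 1)) ?A c 0"
    by (rule has_wirtinger_cong_open)
       (use f in \<open>simp_all only: mem_Collect_eq metric_coeff_grauert_wirtinger(2)[OF f(1)] vector_smult_lzero add_0_right simp_thms\<close>)
  from has_wirtinger_imp(1)[OF this] show ?thesis
    unfolding pd_z_def .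
qed

text \<open>Here \<open>\<alpha> i k\<close> is the first derivative of the metric without its factor \<open>cnj (pderiv_z b f z)\<close>;
  the second term vanishes on the kernel of the differential.\<close>

lemma curv_tensor_grauert:
  fixes f :: "complex^'n::finite \<Rightarrow> complex"
  assumes f: "line_entire f" "f z \<noteq> 0"
  obtains \<alpha> \<gamma> and r :: real where "r \<ge> 0"
    "\<And>i j k l. curv_tensor (grauert_metric f) z i j k l = - of_real r * (\<alpha> i k * cnj (\<alpha> j l))
        - \<gamma> * (pderiv_z i f z * pderiv_z k f z * cnj (pderiv_z j f z) * cnj (pderiv_z l f z))"
proof -
  define t where "t = (cmod (f z))\<^sup>2"
  define E where "E = complex_of_real (weight t)" 
  define E1 where "E1 = complex_of_real (deriv weight t)"
  define E2 where "E2 = complex_of_real (deriv (deriv weight) t)"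
  define N where "N = complex_of_real (grad_square f z)"
  let ?f = "\<lambda>i. pderiv_z i f z" and ?f2 = "\<lambda>i k. pderiv_z k (pderiv_z i f) z"
  define \<alpha> where "\<alpha> i k = E1 * cnj (f z) * ?f i * ?f k + E * ?f2 i k" for i k
  define \<gamma> where "\<gamma> = E2 * (f z * cnj (f z)) + E1 - E1\<^sup>2 * (f z * cnj (f z)) / E"
  \<comment> \<open>Equal to \<open>1 / E - N / (1 + E * N)\<close>: the first summand comes from
    the mixed second derivative, the second from the product of first derivatives.\<close>
  define r where "r = 1 / (weight t * (1 + weight t * grad_square f z))"
  have t1: "weight t \<ge> 1" by (simp add: t_def weight_ge_1)
  then have E0: "E \<noteq> 0" by (auto simp: E_def)
  have "weight t * grad_square f z \<ge> 0" using t1 grad_square_nonneg[of f z] by simp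
  then have "1 + weight t * grad_square f z > 0" by linarith
  then have "complex_of_real (1 + weight t * grad_square f z) \<noteq> 0" by (subst of_real_eq_0_iff) simp
  then have EN: "1 + E * N \<noteq> 0" by (simp add: E_def N_def)
  have r: "r \<ge> 0" using t1 \<open>1 + weight t * grad_square f z > 0\<close> by (simp add: r_def)
  have rc: "complex_of_real r = 1 / (E * (1 + E * N))" by (simp add: r_def E_def N_def)
  have N: "(\<Sum>m\<in>UNIV. ?f m * cnj (?f m)) = N" by (simp add: N_def of_real_grad_square)
  define c where "c = E / (1 + E * N)"
  \<comment> \<open>The squared length of the covector \<open>df\<close> in the inverse
    metric.\<close>
  have trace: "(\<Sum>a\<in>UNIV. \<Sum>b\<in>UNIV. metric_inv_coeff (grauert_metric f) a b z * (cnj (?f b) * ?f a)) = N / (1 + E * N)"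
  proof -
    have "(\<Sum>a\<in>UNIV. \<Sum>b\<in>UNIV. metric_inv_coeff (grauert_metric f) a b z * (cnj (?f b) * ?f a)) =
        (\<Sum>a\<in>UNIV. \<Sum>b\<in>UNIV. (if b = a then ?f a * cnj (?f a) else 0) - c * ((?f a * cnj (?f a)) * (?f b * cnj (?f b))))"
      unfolding metric_inv_coeff_grauert t_def[symmetric]
      by (intro sum.cong refl) (auto simp: c_def E_def N_def algebra_simps)
    also have "\<dots> = N - c * (N * N)"
    proof -
      have "(\<Sum>a\<in>UNIV. \<Sum>b\<in>UNIV. c * ((?f a * cnj (?f a)) * (?f b * cnj (?f b)))) = c * (N * N)"
        by (simp only: N[symmetric] sum_product) (simp only: sum_distrib_left)
      then show ?thesis by (simp add: sum_subtractf N)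
    qed
    also have "\<dots> = N / (1 + E * N)" using EN by (simp add: c_def field_simps)
    finally show ?thesis .
  qed
  have "curv_tensor (grauert_metric f) z i j k l = - of_real r * (\<alpha> i k * cnj (\<alpha> j l))
        - \<gamma> * (?f i * ?f k * cnj (?f j) * cnj (?f l))" for i j k l
  proof -
    have "(\<Sum>a\<in>UNIV. \<Sum>b\<in>UNIV. metric_inv_coeff (grauert_metric f) a b z
          * pd_z k (metric_coeff (grauert_metric f) i b) z * pd_zbar l (metric_coeff (grauert_metric f) a j) z)
      = (\<Sum>a\<in>UNIV. \<Sum>b\<in>UNIV. (\<alpha> i k * cnj (\<alpha> j l)) * (metric_inv_coeff (grauert_metric f) a b z * (cnj (?f b) * ?f a)))"
      unfolding metric_coeff_grauert_wirtinger[OF f] t_def[symmetric] \<alpha>_def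
      by (intro sum.cong refl) (simp add: E_def E1_def algebra_simps)
    also have "\<dots> = (\<alpha> i k * cnj (\<alpha> j l)) * (N / (1 + E * N))"
      by (simp only: sum_distrib_left[symmetric] trace)
    finally have S: "(\<Sum>a\<in>UNIV. \<Sum>b\<in>UNIV. metric_inv_coeff (grauert_metric f) a b z
          * pd_z k (metric_coeff (grauert_metric f) i b) z * pd_zbar l (metric_coeff (grauert_metric f) a j) z)
      = (\<alpha> i k * cnj (\<alpha> j l)) * (N / (1 + E * N))" .
    have cE: "cnj E = E" "cnj E1 = E1" by (simp_all add: E_def E1_def)
    have P: "pd_z k (pd_zbar l (metric_coeff (grauert_metric f) i j)) z =
        \<alpha> i k * cnj (\<alpha> j l) / E + \<gamma> * (?f i * ?f k * cnj (?f j) * cnj (?f l))"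
      unfolding metric_coeff_grauert_wirtinger2[OF f] t_def[symmetric] E_def[symmetric] E1_def[symmetric] E2_def[symmetric]
        \<alpha>_def \<gamma>_def
      using E0 by (simp add: cE field_simps power2_eq_square)
    have "N / (1 + E * N) - 1 / E = - of_real r"
      using E0 EN by (simp add: rc field_simps)
    then have r': "complex_of_real r = 1 / E - N / (1 + E * N)" by (simp add: algebra_simps)
    show ?thesis
      unfolding curv_tensor_def S P r' by (simp add: algebra_simps)
  qed
  with r show ?thesis by (rule that)
qed

text \<open>Contraction with \<open>V\<close> turns the first part of the tensor into
  \<open>- r * |s|^2\<close>, while the second part acquires the factor
  \<open>cnj (cdiff f z V) = 0\<close>.\<close>

lemma hol_sect_curv_kernel_nonpos:
  fixes f :: "complex^'n::finite \<Rightarrow> complex"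
  assumes f: "line_entire f" "f z \<noteq> 0" and V: "cdiff f z V = 0"
  shows "hol_sect_curv (grauert_metric f) z V \<le> 0"
proof -
  obtain \<alpha> \<gamma> and r :: real where r: "r \<ge> 0" and R:
    "\<And>i j k l. curv_tensor (grauert_metric f) z i j k l = - of_real r * (\<alpha> i k * cnj (\<alpha> j l))
        - \<gamma> * (pderiv_z i f z * pderiv_z k f z * cnj (pderiv_z j f z) * cnj (pderiv_z l f z))"
    using curv_tensor_grauert[OF f] by metis
  define s where "s = (\<Sum>i\<in>UNIV. \<Sum>k\<in>UNIV. \<alpha> i k * (V $ i * V $ k))"
  let ?f = "\<lambda>i. pderiv_z i f z"
  have v: "(\<Sum>i\<in>UNIV. ?f i * V $ i) = 0" using V by (simp add: cdiff_def)
  have 1: "(\<Sum>i\<in>UNIV. \<Sum>j\<in>UNIV. \<Sum>k\<in>UNIV. \<Sum>l\<in>UNIV. \<alpha> i k * cnj (\<alpha> j l) * (V $ i * cnj (V $ j) * V $ k * cnj (V $ l)))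
      = s * cnj s"
    unfolding s_def cnj_sum sum_product
    by (intro sum.cong refl) (simp add: sum_distrib_left sum_distrib_right mult_ac)
  have 2: "(\<Sum>l\<in>UNIV. ?f i * ?f k * cnj (?f j) * cnj (?f l) * (V $ i * cnj (V $ j) * V $ k * cnj (V $ l))) = 0" for i j k
  proof -
    have "(\<Sum>l\<in>UNIV. ?f i * ?f k * cnj (?f j) * cnj (?f l) * (V $ i * cnj (V $ j) * V $ k * cnj (V $ l)))
      = ?f i * ?f k * cnj (?f j) * (V $ i * cnj (V $ j) * V $ k) * cnj (\<Sum>l\<in>UNIV. ?f l * V $ l)"
      by (simp add: sum_distrib_left mult_ac)
    then show ?thesis by (simp only: v complex_cnj_zero mult_zero_right)
  qed
  have "(\<Sum>i\<in>UNIV. \<Sum>j\<in>UNIV. \<Sum>k\<in>UNIV. \<Sum>l\<in>UNIV.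
      curv_tensor (grauert_metric f) z i j k l * V $ i * cnj (V $ j) * V $ k * cnj (V $ l))
    = (\<Sum>i\<in>UNIV. \<Sum>j\<in>UNIV. \<Sum>k\<in>UNIV. \<Sum>l\<in>UNIV.
        - of_real r * (\<alpha> i k * cnj (\<alpha> j l) * (V $ i * cnj (V $ j) * V $ k * cnj (V $ l)))
        - \<gamma> * (?f i * ?f k * cnj (?f j) * cnj (?f l) * (V $ i * cnj (V $ j) * V $ k * cnj (V $ l))))"
    unfolding R by (intro sum.cong refl) (simp add: algebra_simps)
  also have "\<dots> = - of_real r * (s * cnj s)"
    by (simp only: sum_subtractf sum_distrib_left[symmetric] 1 2 sum.neutral_const mult_zero_right diff_0_right)
  also have "\<dots> = of_real (- r * (cmod s)\<^sup>2)" by (simp add: of_real_cmod_square)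
  finally have S: "Re (\<Sum>i\<in>UNIV. \<Sum>j\<in>UNIV. \<Sum>k\<in>UNIV. \<Sum>l\<in>UNIV.
      curv_tensor (grauert_metric f) z i j k l * V $ i * cnj (V $ j) * V $ k * cnj (V $ l)) = - r * (cmod s)\<^sup>2"
    by (simp only: Re_complex_of_real)
  show ?thesis
    unfolding hol_sect_curv_def S using r by (intro divide_nonpos_nonneg) auto
qed

section \<open>Curvature near the divisor\<close>

text \<open>On the open unit interval \<open>weight\<close> and its first two derivatives are
  polynomials in \<open>t\<close>, \<open>inverse t\<close> and \<open>inverse (ln t)\<close>, a
  form suited to asymptotic expansion.\<close>

definition log_weight :: "real \<Rightarrow> real" where
  "log_weight t = 1 + (t - 1) ^ 2 * inverse t * inverse (ln t) ^ 2"

definition log_weight1 :: "real \<Rightarrow> real" where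
  "log_weight1 t = 2 * (t - 1) * inverse t * inverse (ln t) ^ 2
     - (t - 1) ^ 2 * inverse t ^ 2 * inverse (ln t) ^ 2 - 2 * (t - 1) ^ 2 * inverse t ^ 2 * inverse (ln t) ^ 3"

definition log_weight2 :: "real \<Rightarrow> real" where
  "log_weight2 t = 2 * inverse t * inverse (ln t) ^ 2
     - 4 * (t - 1) * inverse t ^ 2 * inverse (ln t) ^ 2 - 8 * (t - 1) * inverse t ^ 2 * inverse (ln t) ^ 3
     + 2 * (t - 1) ^ 2 * inverse t ^ 3 * inverse (ln t) ^ 2 + 6 * (t - 1) ^ 2 * inverse t ^ 3 * inverse (ln t) ^ 3
     + 6 * (t - 1) ^ 2 * inverse t ^ 3 * inverse (ln t) ^ 4"

lemma log_weight_DERIV: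
  assumes "0 < t" "t < 1"
  shows "(log_weight has_real_derivative log_weight1 t) (at t)"
    and "(log_weight1 has_real_derivative log_weight2 t) (at t)"
proof -
  have "ln t \<noteq> 0" "t \<noteq> 0" using assms by simp_all
  \<comment> \<open>With these names \<open>x' = - x^2\<close> and \<open>y' = - x * y^2\<close>, so
    both claims become polynomial identities.\<close>
  define x y where "x = inverse t" and "y = inverse (ln t)"
  have x: "(inverse has_real_derivative - (x * x)) (at t)"
    using DERIV_inverse'[OF DERIV_ident \<open>t \<noteq> 0\<close>] by (simp add: x_def)
  have y: "((\<lambda>t. inverse (ln t)) has_real_derivative - (y * x * y)) (at t)"
    using DERIV_inverse'[OF DERIV_ln[OF assms(1)] \<open>ln t \<noteq> 0\<close>] by (simp add: x_def y_def)
  show "(log_weight has_real_derivative log_weight1 t) (at t)"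
    unfolding log_weight_def[abs_def] log_weight1_def
    by (rule x y derivative_eq_intros refl)+
       (simp add: x_def[symmetric] y_def[symmetric] algebra_simps eval_nat_numeral)
  show "(log_weight1 has_real_derivative log_weight2 t) (at t)"
    unfolding log_weight1_def[abs_def] log_weight2_def
    by (rule x y derivative_eq_intros refl)+
       (simp add: x_def[symmetric] y_def[symmetric] algebra_simps eval_nat_numeral)
qed

lemma weight_eq_log_weight:
  assumes "0 < t" "t < 1"
  shows "weight t = log_weight t" "deriv weight t = log_weight1 t" "deriv (deriv weight) t = log_weight2 t"
proof -
  have 0: "weight t = log_weight t" if "0 < t" "t < 1" for t
    using that by (simp add: weight_def log_weight_def u_fun_def power2_eq_square divide_inverse)
  have "(weight has_real_derivative log_weight1 t) (at t)" if "0 < t" "t < 1" for t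
    by (rule has_field_derivative_transform_within_open[OF log_weight_DERIV(1)[OF that], of "{0<..<1}"])
       (use that in \<open>auto simp: 0\<close>)
  then have 1: "deriv weight t = log_weight1 t" if "0 < t" "t < 1" for t
    using that by (auto intro: DERIV_imp_deriv)
  have "(deriv weight has_real_derivative log_weight2 t) (at t)"
    by (rule has_field_derivative_transform_within_open[OF log_weight_DERIV(2)[OF assms], of "{0<..<1}"])
       (use assms in \<open>auto simp: 1\<close>)
  then show "weight t = log_weight t" "deriv weight t = log_weight1 t" "deriv (deriv weight) t = log_weight2 t"
    using 0 1 assms by (auto intro: DERIV_imp_deriv)
qed

text \<open>Near 0 the weight behaves like \<open>1 / (t * (ln t)^2)\<close>. The limit 2,
  multiplied by the \<open>- 2\<close> of the curvature formula, gives \<open>- 4\<close>; the other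
  limits dispose of the terms due to the Euclidean summand.\<close>

lemma weight_limits:
  shows "((\<lambda>t. weight_disc t / weight t ^ 3) \<longlongrightarrow> 2) (at_right 0)"
    and "((\<lambda>t. laplace_weight t / weight t ^ 3) \<longlongrightarrow> 0) (at_right 0)"
    and "((\<lambda>t. sqrt t * deriv weight t / weight t ^ 3) \<longlongrightarrow> 0) (at_right 0)"
    and "((\<lambda>t. 1 / weight t) \<longlongrightarrow> 0) (at_right 0)"
proof -
  have ev: "\<forall>\<^sub>F t in at_right (0::real). 0 < t \<and> t < 1"
    by (auto simp: eventually_at_right_field intro!: exI[of _ 1])
  have "((\<lambda>t. (log_weight t * (log_weight1 t + t * log_weight2 t) - t * (log_weight1 t)\<^sup>2) / log_weight t ^ 3) \<longlongrightarrow> 2) (at_right 0)"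
    unfolding log_weight_def log_weight1_def log_weight2_def by real_asymp
  then show "((\<lambda>t. weight_disc t / weight t ^ 3) \<longlongrightarrow> 2) (at_right 0)"
    by (rule Lim_transform_eventually)
       (use ev in eventually_elim, simp add: weight_eq_log_weight weight_disc_def laplace_weight_def)
  have "((\<lambda>t. (log_weight1 t + t * log_weight2 t) / log_weight t ^ 3) \<longlongrightarrow> 0) (at_right 0)"
    unfolding log_weight_def log_weight1_def log_weight2_def by real_asymp
  then show "((\<lambda>t. laplace_weight t / weight t ^ 3) \<longlongrightarrow> 0) (at_right 0)"
    by (rule Lim_transform_eventually)
       (use ev in eventually_elim, simp add: weight_eq_log_weight laplace_weight_def)
  have "((\<lambda>t. sqrt t * log_weight1 t / log_weight t ^ 3) \<longlongrightarrow> 0) (at_right 0)"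
    unfolding log_weight_def log_weight1_def by real_asymp
  then show "((\<lambda>t. sqrt t * deriv weight t / weight t ^ 3) \<longlongrightarrow> 0) (at_right 0)"
    by (rule Lim_transform_eventually)
       (use ev in eventually_elim, simp add: weight_eq_log_weight)
  have "((\<lambda>t. 1 / log_weight t) \<longlongrightarrow> 0) (at_right 0)"
    unfolding log_weight_def by real_asymp
  then show "((\<lambda>t. 1 / weight t) \<longlongrightarrow> 0) (at_right 0)"
    by (rule Lim_transform_eventually)
       (use ev in eventually_elim, simp add: weight_eq_log_weight)
qed

text \<open>Numerator and denominator of the curvature formula are divided by the cube of the
  weight; then every factor converges, and the denominator has the nonzero limit
  \<open>A p ^ 3\<close>.\<close>

lemma leaf_curvature_tendsto:
  fixes f :: "complex^'n::finite \<Rightarrow> complex"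
  assumes f: "holo_on f UNIV" and p: "f p = 0" "pderiv_z i f p \<noteq> 0"
  shows "(leaf_curvature (grauert_metric f) (UNIV - {z. f z = 0}) (\<lambda>_. axis i 1) \<longlongrightarrow> - 4)
      (at p within - {z. f z = 0})"
proof -
  let ?F = "at p within - {z. f z = 0}"
  define a where "a z = pderiv_z i f z" for z
  define b where "b z = (deriv ^^ 2) (\<lambda>T. f (z + T *s axis i 1)) 0" for z
  define t where "t z = (cmod (f z))\<^sup>2" for z
  define A where "A z = (cmod (a z))\<^sup>2" for z
  have f0: "(f \<longlongrightarrow> 0) ?F"
    using holo_on_continuous[OF f] p(1)
    by (metis UNIV_I continuous_on_def subset_UNIV tendsto_within_subset)
  have a: "(a \<longlongrightarrow> a p) ?F"
    using higher_deriv_line_continuous[OF f, where m = 1 and v = "axis i 1" and p = p]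
    by (auto simp: a_def[abs_def] pderiv_z_def isCont_def intro: tendsto_within_subset)
  have b: "(b \<longlongrightarrow> b p) ?F"
    using higher_deriv_line_continuous[OF f, where m = 2 and v = "axis i 1" and p = p]
    unfolding b_def[abs_def] isCont_def by (rule tendsto_within_subset) simp
  have t: "filterlim t (at_right 0) ?F"
    unfolding filterlim_at
  proof
    have "\<forall>\<^sub>F z in ?F. f z \<noteq> 0" by (auto simp: eventually_at_filter)
    then show "\<forall>\<^sub>F z in ?F. t z \<in> {0<..} \<and> t z \<noteq> 0" by eventually_elim (simp add: t_def)
    show "(t \<longlongrightarrow> 0) ?F"
      unfolding t_def[abs_def] using tendsto_power[OF tendsto_norm[OF f0], of 2] by simp
  qed
  note lim = weight_limits[THEN filterlim_compose, OF t]
  have A: "(A \<longlongrightarrow> A p) ?F" unfolding A_def[abs_def] by (intro tendsto_intros a)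
  have Ap: "A p \<noteq> 0" using p by (simp add: A_def a_def)
  define c where "c z = deriv weight (t z) / weight (t z) ^ 3 * Re (cnj (f z) * (a z)\<^sup>2 * cnj (b z))" for z
  have c: "(c \<longlongrightarrow> 0) ?F"
  \<comment> \<open>The factor \<open>cnj (f z)\<close> has modulus \<open>sqrt (t z)\<close>, which
    matches the third of the weight limits; \<open>a\<close> and \<open>b\<close> stay bounded by
    continuity.\<close>
  proof (rule Lim_null_comparison)
    show "\<forall>\<^sub>F z in ?F. norm (c z) \<le> \<bar>sqrt (t z) * deriv weight (t z) / weight (t z) ^ 3\<bar> * cmod ((a z)\<^sup>2 * cnj (b z))"
    proof (rule always_eventually, rule allI)
      fix z
      have "\<bar>Re (cnj (f z) * (a z)\<^sup>2 * cnj (b z))\<bar> \<le> cmod (cnj (f z) * (a z)\<^sup>2 * cnj (b z))"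
        by (rule abs_Re_le_cmod)
      also have "\<dots> = sqrt (t z) * cmod ((a z)\<^sup>2 * cnj (b z))"
        by (simp add: t_def norm_mult)
      finally have "\<bar>deriv weight (t z) / weight (t z) ^ 3\<bar> * \<bar>Re (cnj (f z) * (a z)\<^sup>2 * cnj (b z))\<bar>
          \<le> \<bar>deriv weight (t z) / weight (t z) ^ 3\<bar> * (sqrt (t z) * cmod ((a z)\<^sup>2 * cnj (b z)))"
        by (rule mult_left_mono) simp
      then show "norm (c z) \<le> \<bar>sqrt (t z) * deriv weight (t z) / weight (t z) ^ 3\<bar> * cmod ((a z)\<^sup>2 * cnj (b z))"
        by (simp add: c_def abs_mult t_def mult_ac)
    qed
    show "((\<lambda>z. \<bar>sqrt (t z) * deriv weight (t z) / weight (t z) ^ 3\<bar> * cmod ((a z)\<^sup>2 * cnj (b z))) \<longlongrightarrow> 0) ?F"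
      using tendsto_mult[OF tendsto_rabs[OF lim(3)] tendsto_norm[OF tendsto_mult[OF tendsto_power[OF a] tendsto_cnj[OF b]]]]
      by simp
  qed
  have "((\<lambda>z. - 2 * (A z ^ 3 * (weight_disc (t z) / weight (t z) ^ 3)
        + ((A z)\<^sup>2 * (laplace_weight (t z) / weight (t z) ^ 3) + 2 * c z + (cmod (b z))\<^sup>2 * (1 / weight (t z))\<^sup>2))
        / (A z + 1 / weight (t z)) ^ 3) \<longlongrightarrow>
      - 2 * (A p ^ 3 * 2 + ((A p)\<^sup>2 * 0 + 2 * 0 + (cmod (b p))\<^sup>2 * 0\<^sup>2)) / (A p + 0) ^ 3) ?F"
    by (intro tendsto_intros A c b lim) (use Ap in simp)
  moreover have "- 2 * (A p ^ 3 * 2 + ((A p)\<^sup>2 * 0 + 2 * 0 + (cmod (b p))\<^sup>2 * 0\<^sup>2)) / (A p + 0) ^ 3 = - 4"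
    using Ap by simp
  ultimately have lim4: "((\<lambda>z. - 2 * (A z ^ 3 * (weight_disc (t z) / weight (t z) ^ 3)
        + ((A z)\<^sup>2 * (laplace_weight (t z) / weight (t z) ^ 3) + 2 * c z + (cmod (b z))\<^sup>2 * (1 / weight (t z))\<^sup>2))
        / (A z + 1 / weight (t z)) ^ 3) \<longlongrightarrow> - 4) ?F"
    by (simp only:)
  show ?thesis
  proof (rule Lim_transform_eventually[OF lim4])
    have "\<forall>\<^sub>F z in ?F. f z \<noteq> 0" by (auto simp: eventually_at_filter)
    then show "\<forall>\<^sub>F z in ?F. - 2 * (A z ^ 3 * (weight_disc (t z) / weight (t z) ^ 3)
        + ((A z)\<^sup>2 * (laplace_weight (t z) / weight (t z) ^ 3) + 2 * c z + (cmod (b z))\<^sup>2 * (1 / weight (t z))\<^sup>2))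
        / (A z + 1 / weight (t z)) ^ 3
      = leaf_curvature (grauert_metric f) (UNIV - {z. f z = 0}) (\<lambda>_. axis i 1) z"
    proof eventually_elim
      case (elim z)
      \<comment> \<open>A constant field: \<open>k = 0\<close>, with the coordinate \<open>i\<close>
        as clock, so \<open>R = 1\<close> and \<open>Q = 0\<close>.\<close>
      interpret parabolic_field "axis i 1" 0 z "\<lambda>v. v $ i"
        by (rule parabolic_field.intro) (auto simp: bounded_linear_vec_nth axis_def)
      have X: "X = (\<lambda>_. axis i 1)" by (simp add: X_def fun_eq_iff)
      have curve: "curve T = z + T *s axis i 1" for T by (simp add: curve_def)
      define E where "E = weight (t z)"
      have E: "E \<noteq> 0" using weight_ge_1[of "t z"] by (simp add: E_def t_def)
      have "leaf_curvature (grauert_metric f) (UNIV - {z. f z = 0}) X z =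
          - 2 * (A z ^ 3 * weight_disc (t z)
           + (laplace_weight (t z) * (A z)\<^sup>2 + 2 * deriv weight (t z) * Re (cnj (f z) * (a z)\<^sup>2 * cnj (b z))
               + E * (cmod (b z))\<^sup>2)) / (E * A z + 1) ^ 3"
        by (subst leaf_curvature_eq[OF f elim])
           (simp_all add: A_def a_def b_def t_def E_def cdiff_axis curve norm_axis_1 flip: power_mult)
      also have "\<dots> = - 2 * (A z ^ 3 * (weight_disc (t z) / E ^ 3)
        + ((A z)\<^sup>2 * (laplace_weight (t z) / E ^ 3) + 2 * c z + (cmod (b z))\<^sup>2 * (1 / E)\<^sup>2))
        / (A z + 1 / E) ^ 3"
      proof -
        have "(A z + 1 / E) ^ 3 = (E * A z + 1) ^ 3 / E ^ 3"
          using E by (simp add: field_simps flip: power_divide)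
        moreover have "A z ^ 3 * (weight_disc (t z) / E ^ 3)
          + ((A z)\<^sup>2 * (laplace_weight (t z) / E ^ 3) + 2 * c z + (cmod (b z))\<^sup>2 * (1 / E)\<^sup>2) =
          (A z ^ 3 * weight_disc (t z)
           + (laplace_weight (t z) * (A z)\<^sup>2 + 2 * deriv weight (t z) * Re (cnj (f z) * (a z)\<^sup>2 * cnj (b z))
               + E * (cmod (b z))\<^sup>2)) / E ^ 3"
          using E unfolding c_def E_def[symmetric]
          by (simp add: add_divide_distrib power2_eq_square power3_eq_cube mult_ac)
        ultimately show ?thesis using E by simp
      qed
      finally show ?case unfolding X E_def ..
    qed
  qed
qed

section \<open>A transversal field of nonpositive leaf curvature off the divisor\<close>

lemma leaf_curvature_nonpos_transversal:
  fixes f :: "complex^'n::finite \<Rightarrow> complex"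
  assumes f: "holo_on f UNIV" "f p \<noteq> 0" and i: "pderiv_z i f p \<noteq> 0" and card: "CARD('n) \<ge> 2"
  obtains X where "nonsingular_holo_vf UNIV X" "cdiff f p (X p) \<noteq> 0"
    "leaf_curvature (grauert_metric f) (UNIV - {z. f z = 0}) X p \<le> 0"
proof -
  let ?f = "\<lambda>m. pderiv_z m f p"
  have "\<exists>j. j \<noteq> i"
  proof (rule ccontr)
    assume "\<nexists>j. j \<noteq> i"
    then have "(UNIV :: 'n set) = {i}" by auto
    then have "CARD('n) = 1" by (metis card_1_singleton_iff One_nat_def)
    then show False using card by simp
  qed
  then obtain j where j: "j \<noteq> i" ..
  define e :: "complex^'n" where "e = (\<chi> m. cnj (?f m))"
  \<comment> \<open>A kernel vector of the differential; dimension at least 2 supplies the second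
    index \<open>j\<close>, and the entry \<open>?f i\<close> at \<open>j\<close> keeps it
    nonzero.\<close>
  define k0 :: "complex^'n" where "k0 = ?f i *s axis j 1 - ?f j *s axis i 1"
  define N where "N = cdiff f p e"
  \<comment> \<open>The threshold in \<open>leaf_curvature_nonpos\<close>; \<open>k\<close> is
    \<open>k0\<close> rescaled to have squared norm \<open>q\<close>.\<close>
  define q where "q = (cmod N) ^ 4 * \<bar>weight_disc ((cmod (f p))\<^sup>2)\<bar>"
  define k where "k = complex_of_real (sqrt q / norm k0) *s k0"
  have N: "N = of_real (grad_square f p)"
    by (simp add: N_def cdiff_def e_def of_real_grad_square)
  have "grad_square f p > 0"
    unfolding grad_square_def by (rule sum_pos2[of _ i]) (use i in auto)
  then have N0: "N \<noteq> 0" by (simp add: N)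
  have k0: "cdiff f p k0 = 0"
    by (simp add: k0_def cdiff_diff cdiff_scale cdiff_axis)
  have "k0 $ j \<noteq> 0" using i j by (simp add: k0_def axis_def)
  then have k00: "k0 \<noteq> 0" by auto
  have lin: "bounded_linear (cdiff f p)"
    using holo_on_has_derivative[OF f(1), of p] has_derivative_bounded_linear by blast
  have sc: "complex_of_real r *s v = r *\<^sub>R v" for r and v :: "complex^'n"
    unfolding vec_eq_iff vector_smult_component vector_scaleR_component by (simp add: scaleR_conv_of_real)
  \<comment> \<open>The differential itself, normalised by its value on \<open>e\<close>, serves as
    clock because it annihilates \<open>k\<close>.\<close>
  interpret parabolic_field e k p "\<lambda>v. cdiff f p v / N"
  proof (rule parabolic_field.intro)
    show "bounded_linear (\<lambda>v. cdiff f p v / N)"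
      by (rule bounded_linear_compose[OF bounded_linear_divide lin])
  qed (use N0 in \<open>simp_all add: cdiff_scale N_def[symmetric] k_def k0\<close>)
  have "cdiff f p (X p) = N"
    using l_X[of p] N0 by (simp add: field_simps)
  moreover have "leaf_curvature (grauert_metric f) (UNIV - {z. f z = 0}) X p \<le> 0"
  proof (rule leaf_curvature_nonpos[OF f])
    \<comment> \<open>Orthogonality to the conjugate gradient is membership in the kernel of the
      differential.\<close>
    have "(\<Sum>m\<in>UNIV. k $ m * cnj (e $ m)) = cdiff f p k"
      by (simp add: e_def cdiff_def mult.commute)
    then show "(\<Sum>m\<in>UNIV. k $ m * cnj (e $ m)) = 0" by (simp add: k_def cdiff_scale k0)
    have "q \<ge> 0" by (simp add: q_def)
    then have "(norm k)\<^sup>2 = q"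
      unfolding k_def sc using k00 by (simp add: power_mult_distrib power_divide)
    then show "(cmod (cdiff f p e)) ^ 4 * \<bar>weight_disc ((cmod (f p))\<^sup>2)\<bar> \<le> (norm k)\<^sup>2"
      by (simp add: q_def N_def)
  qed
  ultimately show ?thesis using that nonsingular N0 by simp
qed

lemma rank_jacobian_row_eq_0:
  assumes "rank (jacobian_row f p) = 0"
  shows "cdiff f p V = 0"
proof -
  have "row 1 (jacobian_row f p) \<in> rows (jacobian_row f p)" by (auto simp: rows_def)
  moreover have "rows (jacobian_row f p) \<subseteq> {0}"
    using assms by (simp add: row_rank_def_gen vec.dim_eq_0)
  ultimately have "row 1 (jacobian_row f p) = 0" by blast
  then have "pderiv_z i f p = 0" for i
    by (auto simp: row_def jacobian_row_def vec_eq_iff)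
  then show ?thesis by (simp add: cdiff_def)
qed

section \<open>Assembly of statements (i) to (iii)\<close>

theorem theorem1p1:
  fixes f :: "complex^'n \<Rightarrow> complex"
    and D :: "('n::finite) divisor"
  assumes "CARD('n) \<ge> 2"
    and "nonneg_principal_divisor D"
    and "holo_on f UNIV" and "\<exists>z. f z \<noteq> 0" and "Div_of f = D"
  shows "(\<forall>p V. p \<notin> div_support D \<and> V \<noteq> 0 \<and> cdiff f p V = 0
            \<longrightarrow> hol_sect_curv (grauert_metric f) p V \<le> 0)
       \<and> (\<forall>p. p \<notin> div_support D \<and> rank (jacobian_row f p) = 0
            \<longrightarrow> hol_sect_curv_sup (grauert_metric f) p \<le> 0)
       \<and> (\<forall>p. p \<notin> div_support D \<and> (\<exists>i. pderiv_z i f p \<noteq> 0)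
            \<longrightarrow> (\<exists>U X. p \<in> U \<and> nonsingular_holo_vf U X \<and> cdiff f p (X p) \<noteq> 0
                  \<and> leaf_curvature (grauert_metric f) (U - div_support D) X p \<le> 0))
       \<and> (\<forall>p. p \<in> div_support D \<and> (\<exists>i. pderiv_z i f p \<noteq> 0)
            \<longrightarrow> (\<exists>U X. p \<in> U \<and> nonsingular_holo_vf U X
                  \<and> (leaf_curvature (grauert_metric f) (U - div_support D) X \<longlongrightarrow> - 4)
                      (at p within - div_support D)))"
proof (intro conjI allI impI; elim conjE exE)
  note f = assms(3)
  have S: "div_support D = {z. f z = 0}"
    using div_support_Div_of[OF assms(3,4)] assms(5) by simp
  have kernel: "hol_sect_curv (grauert_metric f) p V \<le> 0" if "p \<notin> div_support D" "cdiff f p V = 0" for p V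
    using that by (intro hol_sect_curv_kernel_nonpos holo_on_imp_line_entire f) (auto simp: S)
  then show "hol_sect_curv (grauert_metric f) p V \<le> 0" if "p \<notin> div_support D" "cdiff f p V = 0" for p V
    using that by blast
  show "hol_sect_curv_sup (grauert_metric f) p \<le> 0"
    if "p \<notin> div_support D" "rank (jacobian_row f p) = 0" for p
    unfolding hol_sect_curv_sup_def
  proof (rule cSUP_least)
    \<comment> \<open>For a real supremum an upper bound carries over only if the index set is
      nonempty.\<close>
    show "{V::complex^'n. V \<noteq> 0} \<noteq> {}" by (auto intro!: exI[of _ "axis undefined 1"] simp: axis_eq_0_iff)
    show "hol_sect_curv (grauert_metric f) p V \<le> 0" for V
      using kernel[OF that(1)] rank_jacobian_row_eq_0[OF that(2)] by blast
  qed
  show "\<exists>U X. p \<in> U \<and> nonsingular_holo_vf U X \<and> cdiff f p (X p) \<noteq> 0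
      \<and> leaf_curvature (grauert_metric f) (U - div_support D) X p \<le> 0"
    if "p \<notin> div_support D" "pderiv_z i f p \<noteq> 0" for p i
  proof -
    have "f p \<noteq> 0" using that by (simp add: S)
    from leaf_curvature_nonpos_transversal[OF f this that(2) assms(1)]
    show ?thesis unfolding S by (metis UNIV_I)
  qed
  show "\<exists>U X. p \<in> U \<and> nonsingular_holo_vf U X
      \<and> (leaf_curvature (grauert_metric f) (U - div_support D) X \<longlongrightarrow> - 4) (at p within - div_support D)"
    if "p \<in> div_support D" "pderiv_z i f p \<noteq> 0" for p i
  \<comment> \<open>The constant field is defined everywhere, so \<open>U = UNIV\<close>.\<close>
  proof (intro exI conjI)
    show "nonsingular_holo_vf UNIV (\<lambda>_::complex^'n. axis i 1)"
      by (auto simp: nonsingular_holo_vf_def holo_on_def axis_eq_0_iff intro!: exI[of _ "\<lambda>_. 0"])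
    show "(leaf_curvature (grauert_metric f) (UNIV - div_support D) (\<lambda>_. axis i 1) \<longlongrightarrow> - 4)
        (at p within - div_support D)"
      unfolding S by (rule leaf_curvature_tendsto[OF f]) (use that in \<open>auto simp: S\<close>)
  qed simp
qed

end
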